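(* Let $n\ge1$, $\epsilon=0$ and $\theta<\theta^*(1)$. Let $\tilde X_1$ be the (unique) positive definite solution of $A'X+XA-XBR^{-1}B'X+Q=0$, let $X_1$ be the (minimal) positive definite solution of $A'X+XA-X(BR^{-1}B'-\theta W)X+Q=0$, and put $\hat X_1=X_1-\tilde X_1$. Then the cost per agent $J^*(\theta,n)=\mathrm{Tr}(W_nX_n)$, where $X_n=\frac1n I_n\otimes\tilde X_1+\frac1{n^2}E_n\otimes\hat X_1$ is the solution of the $n$-agent generalized Riccati equation, does not depend on the number of agents: $$J^*(\theta,n)=\mathrm{Tr}\left(W(\tilde X_1+\hat X_1)\right)=J^*(\theta,1).$$
   Context: Primes denote transposes and $\otimes$ is the Kronecker product. $A\in\mathbb{R}^{d\times d}$, $B\in\mathbb{R}^{d\times m}$, $G\in\mathbb{R}^{d\times d}$, $W=GG'$; $Q\in\mathbb{R}^{d\times d}$ is symmetric positive semidefinite, $R\in\mathbb{R}^{m\times m}$ is symmetric positive definite; $(A,B)$ is controllable and $(A,Q)$ is observable. Positive definite matrices are symmetric, and "minimal" refers to the positive semidefinite order. $I_n$ is the $n\times n$ identity, $E_n$ the $n\times n$ matrix of ones; $A_n=I_n\otimes A$, $B_n=I_n\otimes B$, $Q_n=I_n\otimes Q$, $R_n=I_n\otimes R$, $W_n=E_n\otimes W$. The $n$-agent generalized Riccati equation (with $\epsilon=0$) is $$A_n'X+XA_n-X\left(nB_nR_n^{-1}B_n'-\theta W_n\right)X+\frac1nQ_n=0 .$$ The critical value is $\theta^*(1)=\sup\{\theta\in\mathbb{R}: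 A'X+XA-X(BR^{-1}B'-\theta W)X+Q=0\text{ has a positive definite solution}\}$. $J^*(\theta,n)=\mathrm{Tr}(W_nX_n)$ is the expression for the optimal cost per agent in the risk-sensitive (linear exponential quadratic Gaussian) tracking problem with $n$ agents, perfect state measurements and no noise in the agents' dynamics. *)

theory Defs
  imports "HOL-Analysis.Analysis"
begin

definition pos_semidef :: "real^'k^'k \<Rightarrow> bool" where
  "pos_semidef X \<longleftrightarrow> transpose X = X \<and> (\<forall>x. 0 \<le> x \<bullet> (X *v x))"

definition pos_def :: "real^'k^'k \<Rightarrow> bool" where
  "pos_def X \<longleftrightarrow> transpose X = X \<and> (\<forall>x. x \<noteq> 0 \<longrightarrow> 0 < x \<bullet> (X *v x))"

definition psd_le :: "real^'k^'k \<Rightarrow> real^'k^'k \<Rightarrow> bool" where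
  "psd_le X Y \<longleftrightarrow> pos_semidef (Y - X)"

(* Kalman rank conditions: full rank of [B, A B, ..., A^(d-1) B], respectively of
   [C; C A; ...; C A^(d-1)].  The functional iterates avoid the power operation on
   vectors, which is componentwise. *)

definition controllable :: "real^'d^'d \<Rightarrow> real^'m^'d \<Rightarrow> bool" where
  "controllable A B \<longleftrightarrow>
     dim (\<Union>k<CARD('d). columns (((\<lambda>M. A ** M) ^^ k) B)) = CARD('d)"

definition observable :: "real^'d^'d \<Rightarrow> real^'d^'p \<Rightarrow> bool" where
  "observable A C \<longleftrightarrow>
     dim (\<Union>k<CARD('d). rows (((\<lambda>M. M ** A) ^^ k) C)) = CARD('d)"

definition kron :: "real^'b^'a \<Rightarrow> real^'e^'c \<Rightarrow> real^('b \<times> 'e)^('a \<times> 'c)" where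
  "kron M N = (\<chi> p q. M $ fst p $ fst q * N $ snd p $ snd q)"

definition ones_mat :: "real^'n^'n" where
  "ones_mat = (\<chi> i j. 1)"

definition riccati_eq ::
  "real^'k^'k \<Rightarrow> real^'k^'k \<Rightarrow> real^'k^'k \<Rightarrow> real^'k^'k \<Rightarrow> bool" where
  "riccati_eq A M Q X \<longleftrightarrow> transpose A ** X + X ** A - X ** M ** X + Q = 0"

(* "Minimal" means least in the semidefinite order; there is at most one such X. *)
definition minimal_pd_solution ::
  "(real^'k^'k \<Rightarrow> bool) \<Rightarrow> real^'k^'k \<Rightarrow> bool" where
  "minimal_pd_solution E X \<longleftrightarrow>
     pos_def X \<and> E X \<and> (\<forall>Y. pos_def Y \<longrightarrow> E Y \<longrightarrow> psd_le X Y)"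

definition single_riccati ::
  "real^'d^'d \<Rightarrow> real^'m^'d \<Rightarrow> real^'d^'d \<Rightarrow> real^'d^'d \<Rightarrow> real^'m^'m \<Rightarrow> real
     \<Rightarrow> real^'d^'d \<Rightarrow> bool" where
  "single_riccati A B W Q R \<theta> X \<longleftrightarrow>
     riccati_eq A (B ** matrix_inv R ** transpose B - \<theta> *\<^sub>R W) Q X"

(* Supremum in the extended reals: the critical value may be infinite. *)
definition theta_star ::
  "real^'d^'d \<Rightarrow> real^'m^'d \<Rightarrow> real^'d^'d \<Rightarrow> real^'d^'d \<Rightarrow> real^'m^'m \<Rightarrow> ereal" where
  "theta_star A B W Q R =
     Sup (ereal ` {\<theta>. \<exists>X. pos_def X \<and> single_riccati A B W Q R \<theta> X})"

(* The agents are indexed by the type 'n, so the number of agents is CARD('n). *)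
definition agent_riccati ::
  "real^'d^'d \<Rightarrow> real^'m^'d \<Rightarrow> real^'d^'d \<Rightarrow> real^'d^'d \<Rightarrow> real^'m^'m \<Rightarrow> real
     \<Rightarrow> real^('n \<times> 'd)^('n::finite \<times> 'd) \<Rightarrow> bool" where
  "agent_riccati A B W Q R \<theta> X \<longleftrightarrow>
     (let n = real CARD('n);
          A\<^sub>n = kron (mat 1 :: real^'n^'n) A;
          B\<^sub>n = kron (mat 1 :: real^'n^'n) B;
          Q\<^sub>n = kron (mat 1 :: real^'n^'n) Q;
          R\<^sub>n = kron (mat 1 :: real^'n^'n) R;
          W\<^sub>n = kron (ones_mat :: real^'n^'n) W
      in riccati_eq A\<^sub>n
           (n *\<^sub>R (B\<^sub>n ** matrix_inv R\<^sub>n ** transpose B\<^sub>n) - \<theta> *\<^sub>R W\<^sub>n)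
           ((1 / n) *\<^sub>R Q\<^sub>n) X)"

definition J_star ::
  "real^'d^'d \<Rightarrow> real^'m^'d \<Rightarrow> real^'d^'d \<Rightarrow> real^'d^'d \<Rightarrow> real^'m^'m \<Rightarrow> real
     \<Rightarrow> 'n::finite itself \<Rightarrow> real" where
  "J_star A B W Q R \<theta> _ =
     trace (kron (ones_mat :: real^'n^'n) W **
            (THE X :: real^('n \<times> 'd)^('n \<times> 'd).
               minimal_pd_solution (agent_riccati A B W Q R \<theta>) X))"

end

theory Submission
  imports Defs
begin

text \<open>Inverting a positive definite solution \<open>X\<close> turns the Riccati equation into
  \<open>A Z + Z A' + Z Q Z = M\<close>, whose left-hand side is convex in \<open>Z\<close>; the least solution \<open>X\<close> corresponds
  to the greatest \<open>Z\<close>.  Newton's iteration yields a solution that dominates every subsolution, as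
  soon as one subsolution and one strictly antistable starting point exist.  For the scaled \<open>n\<close>-agent
  equation the compression of the greatest \<open>Z\<close> to \<open>w \<otimes> \<real>\<^sup>d\<close>, with \<open>w\<close> a unit eigenvector of the
  matrix of ones, is by convexity a subsolution of one of the two single-agent equations.  So \<open>Z\<close> minus
  the inverse of the candidate \<open>n X\<^sub>n\<close> is positive semidefinite with vanishing diagonal blocks, hence
  zero.\<close>

text \<open>\<open>J_star\<close> takes the least of all positive definite solutions, so the
  candidate must be compared with solutions that couple the agents arbitrarily, not only with those
  of block form. For positive \<open>\<theta>\<close> the quadratic coefficient of the Riccati
  equation may be indefinite, which spoils the usual comparison of solutions. Inversion moves that
  matrix into the constant term \<open>M\<close> and leaves the semidefinite \<open>Q\<close> in the
  quadratic one. The derivative of the left-hand side at \<open>Z\<close> is the Lyapunov operator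
  of \<open>A + Z ** Q\<close> and does not contain \<open>M\<close>. Hence the inverse of
  \<open>X1_tilde\<close>, which solves the equation for \<open>\<theta> = 0\<close>, is a starting
  point for every \<open>M\<close>; controllability supplies the antistability there. The matrix of
  ones has the eigenvalue n and, for more than one agent, 0. On the eigenspace of 0 the scaled
  equation is the single-agent one for \<open>\<theta> = 0\<close>, on that of n the one for the
  given \<open>\<theta>\<close>. The noise matrix \<open>E \<otimes> W\<close> sees only the latter,
  which is why n disappears from the trace.\<close>

lemma matrix_add_rdistrib: "((A::real^'b^'a) + B) ** C = A ** C + B ** C"
  by (vector matrix_matrix_mult_def sum.distrib algebra_simps)

lemma matrix_diff_ldistrib: "(A::real^'b^'a) ** (B - C) = A ** B - A ** C"
  by (vector matrix_matrix_mult_def sum_subtractf algebra_simps)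

lemma matrix_diff_rdistrib: "((A::real^'b^'a) - B) ** C = A ** C - B ** C"
  by (vector matrix_matrix_mult_def sum_subtractf algebra_simps)

lemma matrix_scaleR_left: "(c *\<^sub>R (A::real^'b^'a)) ** B = c *\<^sub>R (A ** B)"
  by (vector matrix_matrix_mult_def sum_distrib_left algebra_simps)

lemma matrix_scaleR_right: "(A::real^'b^'a) ** (c *\<^sub>R B) = c *\<^sub>R (A ** B)"
  by (vector matrix_matrix_mult_def sum_distrib_left algebra_simps)

lemma matrix_zero_left: "(0::real^'b^'a) ** B = 0"
  by (vector matrix_matrix_mult_def)

lemma matrix_zero_right: "(A::real^'b^'a) ** 0 = 0"
  by (vector matrix_matrix_mult_def)

lemma transpose_add: "transpose ((A::real^'b^'a) + B) = transpose A + transpose B"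
  by (vector transpose_def)

lemma transpose_diff: "transpose ((A::real^'b^'a) - B) = transpose A - transpose B"
  by (vector transpose_def)

lemma transpose_zero: "transpose (0::real^'b^'a) = 0"
  by (vector transpose_def)

lemma scaleR_matrix_vector: "(c *\<^sub>R (A::real^'b^'a)) *v x = c *\<^sub>R (A *v x)"
  by (simp add: scaleR_matrix_vector_assoc)

lemmas matrix_distribs =
  matrix_add_ldistrib matrix_add_rdistrib matrix_diff_ldistrib matrix_diff_rdistrib
  matrix_scaleR_left matrix_scaleR_right matrix_zero_left matrix_zero_right

lemmas transpose_distribs =
  transpose_add transpose_diff transpose_zero transpose_scalar matrix_transpose_mul

lemmas matrix_vector_distribs =
  matrix_vector_right_distrib matrix_vector_mult_diff_distrib matrix_vector_mult_scaleR
  matrix_vector_mult_add_rdistrib matrix_vector_mult_diff_rdistrib scaleR_matrix_vector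

declare transpose_matrix_vector [simp del]

lemma inner_matrix_vector: "x \<bullet> ((A::real^'b^'a) *v y) = (transpose A *v x) \<bullet> y"
  by (simp add: dot_lmul_matrix transpose_matrix_vector)

section \<open>The semidefinite order and matrix inversion\<close>

lemma pos_semidefD: "pos_semidef X \<Longrightarrow> 0 \<le> x \<bullet> (X *v x)"
  by (simp add: pos_semidef_def)

lemma pos_def_imp_pos_semidef: "pos_def X \<Longrightarrow> pos_semidef X"
  unfolding pos_def_def pos_semidef_def by (metis inner_zero_left less_eq_real_def)

lemma pos_semidef_zero: "pos_semidef 0"
  by (simp add: pos_semidef_def transpose_zero)

lemma pos_semidef_add: "pos_semidef X \<Longrightarrow> pos_semidef Y \<Longrightarrow> pos_semidef (X + Y)"
  by (simp add: pos_semidef_def transpose_distribs matrix_vector_distribs inner_add_right)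

lemma pos_def_add_pos_semidef: "pos_semidef X \<Longrightarrow> pos_def Y \<Longrightarrow> pos_def (X + Y)"
  by (simp add: pos_semidef_def pos_def_def transpose_distribs matrix_vector_distribs
      inner_add_right add_nonneg_pos)

lemma pos_semidef_scaleR: "pos_semidef X \<Longrightarrow> 0 \<le> c \<Longrightarrow> pos_semidef (c *\<^sub>R X)"
  by (simp add: pos_semidef_def transpose_distribs matrix_vector_distribs)

lemma pos_def_scaleR: "pos_def X \<Longrightarrow> 0 < c \<Longrightarrow> pos_def (c *\<^sub>R X)"
  by (simp add: pos_def_def transpose_distribs matrix_vector_distribs)

lemma pos_def_mat_1: "pos_def (mat 1)"
  by (simp add: pos_def_def)

lemma inner_congruence:
  fixes L :: "real^'b^'a"
  shows "x \<bullet> ((transpose L ** Q ** L) *v x) = (L *v x) \<bullet> (Q *v (L *v x))"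
  by (simp add: matrix_vector_mul_assoc[symmetric] inner_matrix_vector[of x "transpose L"])

lemma pos_semidef_congruence:
  fixes L :: "real^'b^'a"
  assumes "pos_semidef Q"
  shows "pos_semidef (transpose L ** Q ** L)"
  using assms unfolding pos_semidef_def inner_congruence
  by (simp add: matrix_transpose_mul matrix_mul_assoc)

lemma pos_semidef_sandwich:
  fixes X :: "real^'k^'k"
  assumes "pos_semidef Q" "transpose X = X"
  shows "pos_semidef (X ** Q ** X)"
  using pos_semidef_congruence[OF assms(1), of X] assms(2) by simp

text \<open>The vector \<open>v\<close> minimizes a nonnegative quadratic form, so the gradient
  \<open>2 K v\<close> vanishes; the proof perturbs \<open>v\<close> in the direction
  \<open>K v\<close>.\<close>

lemma pos_semidef_kernel:
  assumes K: "pos_semidef K" and v: "v \<bullet> (K *v v) = 0"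
  shows "K *v v = 0"
proof (rule ccontr)
  assume "K *v v \<noteq> 0"
  define y where "y = K *v v"
  have y: "y \<bullet> y > 0" using \<open>K *v v \<noteq> 0\<close> by (simp add: y_def)
  have vy: "v \<bullet> (K *v y) = y \<bullet> y"
    using K by (simp add: inner_matrix_vector[of v] pos_semidef_def y_def)
  have q: "0 \<le> 2 * t * (y \<bullet> y) + t\<^sup>2 * (y \<bullet> (K *v y))" for t
  proof -
    have "0 \<le> (v + t *\<^sub>R y) \<bullet> (K *v (v + t *\<^sub>R y))" by (rule pos_semidefD[OF K])
    also have "\<dots> = 2 * t * (y \<bullet> y) + t\<^sup>2 * (y \<bullet> (K *v y))"
      using v vy by (simp add: matrix_vector_distribs inner_distrib y_def[symmetric]
          power2_eq_square algebra_simps)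
    finally show ?thesis .
  qed
  define b where "b = y \<bullet> (K *v y)"
  have b: "b \<ge> 0" unfolding b_def by (rule pos_semidefD[OF K])
  \<comment> \<open>Negative, yet small enough that \<open>t * b\<close> stays above
    \<open>- (y \<bullet> y)\<close>; the added 1 also covers \<open>b = 0\<close>.\<close>
  define t where "t = - (y \<bullet> y) / (b + 1)"
  have t: "t < 0" using y b by (simp add: t_def divide_neg_pos)
  have "0 \<le> t * (2 * (y \<bullet> y) + t * b)"
    using q[of t] by (simp add: b_def power2_eq_square algebra_simps)
  then have "2 * (y \<bullet> y) + t * b \<le> 0" using t by (simp add: zero_le_mult_iff)
  moreover have "t * b \<ge> - (y \<bullet> y)"
    using y b by (simp add: t_def field_simps)
  ultimately show False using y by simp
qed

lemma pos_semidef_sum_kernel: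
  assumes "pos_semidef X" "pos_semidef Y" "v \<bullet> ((X + Y) *v v) = 0"
  shows "X *v v = 0" "Y *v v = 0"
proof -
  have "v \<bullet> (X *v v) + v \<bullet> (Y *v v) = 0"
    using assms(3) by (simp add: matrix_vector_distribs inner_add_right)
  then have "v \<bullet> (X *v v) = 0" "v \<bullet> (Y *v v) = 0"
    using pos_semidefD[OF assms(1), of v] pos_semidefD[OF assms(2), of v] by linarith+
  then show "X *v v = 0" "Y *v v = 0" using assms pos_semidef_kernel by blast+
qed

lemma symmetric_zero_quadratic_form:
  fixes X :: "real^'k^'k"
  assumes "transpose X = X" "\<And>x. x \<bullet> (X *v x) = 0"
  shows "X = 0"
proof -
  have "pos_semidef X" using assms by (simp add: pos_semidef_def)
  then have "X *v x = 0" for x using assms(2) pos_semidef_kernel by blast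
  then show ?thesis by (simp add: matrix_eq)
qed

lemma psd_le_antisym:
  fixes X :: "real^'k^'k"
  assumes "psd_le X Y" "psd_le Y X"
  shows "X = Y"
proof -
  have "x \<bullet> ((X - Y) *v x) = 0" for x
  proof -
    have "0 \<le> x \<bullet> ((Y - X) *v x)" "0 \<le> x \<bullet> ((X - Y) *v x)"
      using assms pos_semidefD unfolding psd_le_def by blast+
    then show ?thesis by (simp add: matrix_vector_distribs inner_diff_right)
  qed
  moreover have "transpose (X - Y) = X - Y" using assms by (simp add: psd_le_def pos_semidef_def)
  ultimately have "X - Y = 0" by (intro symmetric_zero_quadratic_form)
  then show ?thesis by simp
qed

lemma psd_le_trans:
  assumes "psd_le X Y" "psd_le Y Z"
  shows "psd_le X Z"
  using pos_semidef_add[of "Y - X" "Z - Y"] assms by (simp add: psd_le_def)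

lemma pos_def_inverse:
  assumes "pos_def (X::real^'k^'k)"
  shows "X ** matrix_inv X = mat 1" "matrix_inv X ** X = mat 1" "pos_def (matrix_inv X)"
proof -
  have "X *v x = 0 \<Longrightarrow> x = 0" for x
    using assms unfolding pos_def_def by (metis inner_zero_right less_irrefl)
  then obtain Y where Y: "Y ** X = mat 1"
    using matrix_left_invertible_ker[of X] by blast
  then have Y': "X ** Y = mat 1" by (simp add: matrix_left_right_inverse)
  then have "invertible X" using Y by (auto simp: invertible_def)
  then show 1: "X ** matrix_inv X = mat 1" and 2: "matrix_inv X ** X = mat 1"
    by (simp_all add: matrix_inv_def invertible_def) (metis (mono_tags, lifting) someI_ex)+
  let ?Z = "matrix_inv X"
  have "transpose ?Z ** X = mat 1"
    using arg_cong[OF 1, of transpose] assms by (simp add: matrix_transpose_mul pos_def_def)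
  then have s: "transpose ?Z = ?Z"
    using 1 by (metis matrix_mul_assoc matrix_mul_lid matrix_mul_rid)
  have "0 < x \<bullet> (?Z *v x)" if "x \<noteq> 0" for x
  proof -
    have x: "X *v (?Z *v x) = x" by (simp add: matrix_vector_mul_assoc 1)
    then have "?Z *v x \<noteq> 0" using that by auto
    then have "0 < (?Z *v x) \<bullet> (X *v (?Z *v x))" using assms unfolding pos_def_def by blast
    then show ?thesis by (simp add: x inner_commute)
  qed
  then show "pos_def ?Z" using s by (simp add: pos_def_def)
qed

text \<open>With \<open>X u = Y w = x\<close>, expanding the \<open>X\<close>-form at
  \<open>u - w\<close> and using \<open>X \<le> Y\<close> at \<open>w\<close> gives the claim
  without square roots of matrices.\<close>

lemma pos_def_psd_le_inverse:
  fixes X Y :: "real^'k^'k"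
  assumes "pos_def X" "pos_def Y" "psd_le X Y"
  shows "psd_le (matrix_inv Y) (matrix_inv X)"
proof -
  let ?X = "matrix_inv X" and ?Y = "matrix_inv Y"
  have t: "transpose X = X" "transpose ?X = ?X" "transpose ?Y = ?Y" "transpose Y = Y"
    using assms pos_def_inverse(3) by (auto simp: pos_def_def)
  have "0 \<le> x \<bullet> ((?X - ?Y) *v x)" for x
  proof -
    define u where "u = ?X *v x"
    define w where "w = ?Y *v x"
    have Xu: "X *v u = x" and Yw: "Y *v w = x"
      using assms by (simp_all add: u_def w_def matrix_vector_mul_assoc pos_def_inverse)
    have uXw: "u \<bullet> (X *v w) = x \<bullet> w"
      using inner_matrix_vector[of u X w] t Xu by simp
    have "0 \<le> (u - w) \<bullet> (X *v (u - w))"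
      using assms pos_def_imp_pos_semidef pos_semidefD by blast
    also have "\<dots> = x \<bullet> u - 2 * (x \<bullet> w) + w \<bullet> (X *v w)"
      using uXw Xu by (simp add: matrix_vector_mult_diff_distrib inner_diff_left inner_diff_right
          inner_commute[of _ x])
    finally have 1: "0 \<le> x \<bullet> u - 2 * (x \<bullet> w) + w \<bullet> (X *v w)" .
    have "0 \<le> w \<bullet> ((Y - X) *v w)"
      using assms pos_semidefD unfolding psd_le_def by blast
    then have "w \<bullet> (X *v w) \<le> x \<bullet> w"
      using Yw by (simp add: matrix_vector_mult_diff_rdistrib inner_diff_right inner_commute[of _ x])
    with 1 have "0 \<le> x \<bullet> (u - w)" by (simp add: inner_diff_right)
    then show ?thesis by (simp add: u_def w_def matrix_vector_mult_diff_rdistrib)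
  qed
  then show ?thesis using t by (simp add: psd_le_def pos_semidef_def transpose_distribs)
qed

text \<open>Here \<open>- c\<close> is the least generalized eigenvalue of \<open>N\<close> relative
  to \<open>H\<close>, obtained as the minimum of a Rayleigh quotient on the unit sphere, and
  \<open>v\<close> is a minimizer. A failure of semidefiniteness thus yields a kernel vector, at
  which Lyapunov forms vanish by \<open>lyapunov_kernel\<close>.\<close>

lemma pencil_kernel:
  fixes N H :: "real^'k^'k"
  assumes N: "transpose N = N" "\<not> pos_semidef N" and H: "pos_def H"
  obtains c v where "c > 0" "v \<noteq> 0" "pos_semidef (N + c *\<^sub>R H)" "(N + c *\<^sub>R H) *v v = 0"
proof -
  define f where "f x = (x \<bullet> (N *v x)) / (x \<bullet> (H *v x))" for x
  have Hpos: "0 < x \<bullet> (H *v x)" if "x \<noteq> 0" for x using H that by (simp add: pos_def_def)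
  have nz: "\<forall>x\<in>sphere 0 1. x \<bullet> (H *v x) \<noteq> 0"
  proof
    fix x :: "real^'k"
    assume "x \<in> sphere 0 1"
    then have "x \<noteq> 0" by auto
    then show "x \<bullet> (H *v x) \<noteq> 0" using Hpos[of x] by simp
  qed
  have c: "continuous_on (sphere 0 1) f"
    unfolding f_def
    by (intro continuous_on_divide continuous_on_inner continuous_on_id
        linear_continuous_on matrix_vector_mul_bounded_linear) (use nz in \<open>simp\<close>)
  have "sphere (0::real^'k) 1 \<noteq> {}" by simp
  then obtain v where v: "v \<in> sphere 0 1" and vmin: "\<And>x. x \<in> sphere 0 1 \<Longrightarrow> f v \<le> f x"
    using continuous_attains_inf[OF compact_sphere _ c] by auto
  have fscale: "f (a *\<^sub>R x) = f x" if "a \<noteq> 0" for a x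
    using that by (simp add: f_def matrix_vector_distribs)
  have min: "f v \<le> f x" if "x \<noteq> 0" for x
  proof -
    have "f v \<le> f ((1 / norm x) *\<^sub>R x)" using that by (intro vmin) simp
    then show ?thesis using fscale[of "1 / norm x" x] that by simp
  qed
  have form: "x \<bullet> ((N + (- f v) *\<^sub>R H) *v x) = x \<bullet> (N *v x) - f v * (x \<bullet> (H *v x))" for x
    by (simp add: matrix_vector_distribs inner_distrib inner_diff_right)
  have psd: "pos_semidef (N + (- f v) *\<^sub>R H)"
    unfolding pos_semidef_def form
  proof safe
    show "transpose (N + (- f v) *\<^sub>R H) = N + (- f v) *\<^sub>R H"
      using N H by (simp add: pos_def_def transpose_distribs)
    fix x
    show "0 \<le> x \<bullet> (N *v x) - f v * (x \<bullet> (H *v x))"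
    proof (cases "x = 0")
      case False
      then show ?thesis using min[OF False] Hpos[OF False] by (simp add: f_def[of x] field_simps)
    qed simp
  qed
  have v0: "v \<noteq> 0" using v by auto
  obtain x where x: "x \<bullet> (N *v x) < 0" using N by (auto simp: pos_semidef_def not_le)
  then have "x \<noteq> 0" by auto
  then have "f x < 0" using x Hpos[of x] by (simp add: f_def divide_neg_pos)
  then have "f v < 0" using min[OF \<open>x \<noteq> 0\<close>] by simp
  moreover have "(N + (- f v) *\<^sub>R H) *v v = 0"
    by (rule pos_semidef_kernel[OF psd], unfold form) (use Hpos[OF v0] in \<open>simp add: f_def\<close>)
  ultimately show thesis using that[of "- f v" v] psd v0 by simp
qed

section \<open>Antistability and Lyapunov equations\<close>

text \<open>Equivalent to all eigenvalues of \<open>F\<close> having positive real part. The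
  order-theoretic form is what the comparisons use, and it avoids complex eigenvalues and matrix
  exponentials.\<close>

definition antistable :: "real^'k^'k \<Rightarrow> bool" where
  "antistable F \<longleftrightarrow>
     (\<forall>N. transpose N = N \<longrightarrow> pos_semidef (F ** N + N ** transpose F) \<longrightarrow> pos_semidef N)"

lemma antistableD:
  "antistable F \<Longrightarrow> transpose N = N \<Longrightarrow> pos_semidef (F ** N + N ** transpose F) \<Longrightarrow> pos_semidef N"
  by (simp add: antistable_def)

lemma lyapunov_kernel:
  fixes F K :: "real^'k^'k"
  assumes "transpose K = K" "K *v v = 0"
  shows "v \<bullet> ((F ** K + K ** transpose F) *v v) = 0"
  using assms
  by (simp add: matrix_vector_distribs inner_add_right matrix_vector_mul_assoc[symmetric]
      inner_matrix_vector[of v K])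

text \<open>If \<open>N\<close> were not semidefinite, a shift \<open>N + c H\<close> would have a
  kernel vector \<open>v\<close>. The Lyapunov form of the shift vanishes at \<open>v\<close>, but
  it is at least \<open>c\<close> times a positive definite form.\<close>

lemma antistable_if_lyapunov_pos_def:
  fixes F H :: "real^'k^'k"
  assumes H: "pos_def H" and FH: "pos_def (F ** H + H ** transpose F)"
  shows "antistable F"
  unfolding antistable_def
proof (intro allI impI, rule ccontr)
  fix N assume N: "transpose N = N" and P: "pos_semidef (F ** N + N ** transpose F)"
    and not: "\<not> pos_semidef N"
  obtain c v where c: "c > 0" "v \<noteq> 0" and K: "pos_semidef (N + c *\<^sub>R H)" "(N + c *\<^sub>R H) *v v = 0"
    using pencil_kernel[OF N not H] by blast
  have "0 = v \<bullet> ((F ** (N + c *\<^sub>R H) + (N + c *\<^sub>R H) ** transpose F) *v v)"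
    using lyapunov_kernel[of "N + c *\<^sub>R H" v F] K by (simp add: pos_semidef_def)
  also have "\<dots> = v \<bullet> ((F ** N + N ** transpose F) *v v) + c * (v \<bullet> ((F ** H + H ** transpose F) *v v))"
    by (simp add: matrix_distribs matrix_vector_distribs inner_distrib algebra_simps)
  also have "\<dots> > 0"
    using c FH pos_semidefD[OF P, of v] by (simp add: pos_def_def add_nonneg_pos)
  finally show False by simp
qed

text \<open>Antistability applied to \<open>N\<close> and to \<open>- N\<close> makes the Lyapunov
  operator injective on the symmetric matrices. It maps this finite-dimensional space into itself,
  so it is onto.\<close>

lemma lyapunov_equation_solvable:
  fixes F C :: "real^'k^'k"
  assumes F: "antistable F" and C: "transpose C = C"
  obtains N where "transpose N = N" "F ** N + N ** transpose F = C"
proof -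
  define f where "f N = F ** N + N ** transpose F" for N
  define S where "S = {N::real^'k^'k. transpose N = N}"
  have lin: "linear f"
    by (rule linearI) (simp_all add: f_def matrix_distribs scaleR_add_right add_ac)
  have S: "subspace S"
    by (simp add: subspace_def S_def transpose_distribs)
  have zero: "N = 0" if "N \<in> S" "f N = 0" for N
  proof -
    have "pos_semidef N"
    proof (rule antistableD[OF F])
      show "transpose N = N" using that(1) by (simp only: S_def mem_Collect_eq)
      show "pos_semidef (F ** N + N ** transpose F)"
        using that(2) by (simp only: f_def pos_semidef_zero)
    qed
    moreover have "pos_semidef (0 - N)"
    proof (rule antistableD[OF F])
      show "transpose (0 - N) = 0 - N" using that(1) by (simp only: S_def mem_Collect_eq transpose_diff transpose_zero)
      have "f (0 - N) = 0" using that(2) linear_diff[OF lin, of 0 N] linear_0[OF lin] by simp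
      then show "pos_semidef (F ** (0 - N) + (0 - N) ** transpose F)"
        by (simp only: f_def pos_semidef_zero)
    qed
    ultimately show ?thesis
      using psd_le_antisym[of N 0] by (simp add: psd_le_def)
  qed
  have span: "span S = S" by (rule span_eq_iff[THEN iffD2, OF S])
  have inj: "inj_on f (span S)"
    unfolding span linear_injective_on_subspace_0[OF lin S] by (intro ballI impI) (rule zero)
  have sub: "f ` S \<subseteq> S"
  proof
    fix Y assume "Y \<in> f ` S"
    then obtain N where "Y = f N" "transpose N = N" by (auto simp: S_def)
    then show "Y \<in> S"
      by (simp only: S_def f_def mem_Collect_eq transpose_distribs transpose_transpose add.commute)
  qed
  have "f ` S = S"
    by (rule subspace_dim_equal[OF linear_subspace_image[OF lin S] S sub])
      (simp only: dim_image_eq[OF lin inj] order_refl)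
  then have "C \<in> f ` S" using C by (simp add: S_def)
  then obtain N where "C = f N" "N \<in> S" by (rule imageE)
  then show thesis by (intro that[of N]) (simp_all only: S_def f_def mem_Collect_eq)
qed

section \<open>The dual equation and Newton's iteration\<close>

definition dual_residual :: "real^'k^'k \<Rightarrow> real^'k^'k \<Rightarrow> real^'k^'k \<Rightarrow> real^'k^'k \<Rightarrow> real^'k^'k" where
  "dual_residual A M Q Z = A ** Z + Z ** transpose A + Z ** Q ** Z - M"

text \<open>The exact second-order Taylor expansion at \<open>Z\<close>, in which \<open>M\<close>
  cancels. For semidefinite \<open>Q\<close> the remainder is semidefinite; this is where convexity
  enters the comparisons.\<close>

lemma dual_residual_diff:
  assumes "transpose Q = Q" "transpose Z = Z" "transpose V = V"
  shows "(A + Z ** Q) ** (Z - V) + (Z - V) ** transpose (A + Z ** Q)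
       = (Z - V) ** Q ** (Z - V) + dual_residual A M Q Z - dual_residual A M Q V"
  using assms by (simp add: dual_residual_def transpose_distribs matrix_distribs matrix_mul_assoc algebra_simps)

text \<open>The last hypothesis says that the linearization of the residual at \<open>Z\<close>
  takes the value \<open>E\<close> at \<open>Z'\<close>; \<open>E = 0\<close> would be the plain
  Newton step.\<close>

lemma dual_residual_Newton:
  assumes "transpose Q = Q" "transpose Z = Z" "transpose Z' = Z'"
    and "(A + Z ** Q) ** Z' + Z' ** transpose (A + Z ** Q) = Z ** Q ** Z + M + E"
  shows "transpose V = V \<Longrightarrow> (A + Z ** Q) ** (Z' - V) + (Z' - V) ** transpose (A + Z ** Q)
       = (Z - V) ** Q ** (Z - V) - dual_residual A M Q V + E"
    and "dual_residual A M Q Z' = (Z' - Z) ** Q ** (Z' - Z) + E"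
proof -
  have *: "A ** Z' + Z' ** transpose A = Z ** Q ** Z + M + E - Z ** Q ** Z' - Z' ** Q ** Z"
    using assms by (simp add: transpose_distribs matrix_distribs matrix_mul_assoc algebra_simps)
  show "dual_residual A M Q Z' = (Z' - Z) ** Q ** (Z' - Z) + E"
    using * by (simp add: dual_residual_def matrix_distribs matrix_mul_assoc algebra_simps)
  show "(A + Z ** Q) ** (Z' - V) + (Z' - V) ** transpose (A + Z ** Q)
       = (Z - V) ** Q ** (Z - V) - dual_residual A M Q V + E" if "transpose V = V"
    using * assms(1-3) that
    by (simp add: dual_residual_def transpose_distribs matrix_distribs matrix_mul_assoc algebra_simps)
qed

text \<open>For \<open>F = A + Z ** Q\<close> the equation gives
  \<open>F Z + Z F' = S + Z Q Z\<close>, which is only semidefinite. The criterion for a definite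
  right-hand side is therefore replaced by an invariance argument, in which \<open>ctrl\<close>
  excludes a nonzero kernel vector.\<close>

lemma antistable_if_dual_solution:
  fixes A S Q Z :: "real^'k^'k"
  assumes Z: "pos_def Z" and R: "dual_residual A S Q Z = 0"
    and Q: "pos_semidef Q" and S: "pos_semidef S"
    and ctrl: "\<And>v. (\<And>k. S *v (((*v) (transpose A) ^^ k) v) = 0) \<Longrightarrow> v = 0"
  shows "antistable (A + Z ** Q)"
  unfolding antistable_def
proof (intro allI impI, rule ccontr)
  let ?F = "A + Z ** Q"
  fix N assume N: "transpose N = N" and P: "pos_semidef (?F ** N + N ** transpose ?F)"
    and not: "\<not> pos_semidef N"
  have tZ: "transpose Z = Z" and tQ: "transpose Q = Q"
    using Z Q by (simp_all add: pos_def_def pos_semidef_def)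
  obtain c v where c: "c > 0" and v: "v \<noteq> 0"
    and K: "pos_semidef (N + c *\<^sub>R Z)" "(N + c *\<^sub>R Z) *v v = 0"
    using pencil_kernel[OF N not Z] by blast
  define K where "K = N + c *\<^sub>R Z"
  have tK: "transpose K = K" using K by (simp add: K_def pos_semidef_def)
  let ?E = "c *\<^sub>R S + c *\<^sub>R (Z ** Q ** Z)"
  have ZQZ: "pos_semidef (Z ** Q ** Z)" by (rule pos_semidef_sandwich[OF Q tZ])
  have E: "pos_semidef ?E"
    using c S ZQZ by (intro pos_semidef_add pos_semidef_scaleR) auto
  have *: "A ** Z + Z ** transpose A = S - Z ** Q ** Z"
    using R by (simp add: dual_residual_def algebra_simps)
  have "?F ** K + K ** transpose ?F = (?F ** N + N ** transpose ?F)
      + (c *\<^sub>R (A ** Z + Z ** transpose A) + (c *\<^sub>R (Z ** Q ** Z) + c *\<^sub>R (Z ** Q ** Z)))"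
    using tZ tQ by (simp add: K_def transpose_distribs matrix_distribs matrix_mul_assoc
        algebra_simps)
  then have lyap: "?F ** K + K ** transpose ?F = (?F ** N + N ** transpose ?F) + ?E"
    unfolding * by (simp add: scaleR_diff_right)
  \<comment> \<open>A vanishing sum of semidefinite forms forces each summand to annihilate
    \<open>w\<close>. In particular \<open>Q Z w = 0\<close>, so \<open>F' w = A' w\<close>, and the
    kernel of \<open>K\<close> is invariant under \<open>A'\<close>.\<close>
  have step: "S *v w = 0 \<and> K *v (transpose A *v w) = 0" if w: "K *v w = 0" for w
  proof -
    have "w \<bullet> ((?F ** N + N ** transpose ?F + ?E) *v w) = 0"
      using lyapunov_kernel[OF tK w, of ?F] lyap by simp
    then have Pw: "(?F ** N + N ** transpose ?F) *v w = 0" and Ew: "?E *v w = 0"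
      using pos_semidef_sum_kernel[OF P E] by blast+
    then have "(c *\<^sub>R S) *v w = 0" "(c *\<^sub>R (Z ** Q ** Z)) *v w = 0"
      using pos_semidef_sum_kernel[of "c *\<^sub>R S" "c *\<^sub>R (Z ** Q ** Z)" w] c S ZQZ
      by (auto simp: pos_semidef_scaleR)
    then have Sw: "S *v w = 0" and ZQZw: "(Z ** Q ** Z) *v w = 0"
      using c by (simp_all add: scaleR_matrix_vector)
    have "(Z *v w) \<bullet> (Q *v (Z *v w)) = 0"
      using ZQZw inner_congruence[of w Z Q] tZ by simp
    then have QZw: "Q *v (Z *v w) = 0" by (rule pos_semidef_kernel[OF Q])
    have "(?F ** K + K ** transpose ?F) *v w = 0"
      unfolding lyap using Pw Ew by (simp add: matrix_vector_mult_add_rdistrib)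
    then have "K *v (transpose ?F *v w) = 0"
      using w by (simp add: matrix_vector_distribs matrix_vector_mul_assoc[symmetric])
    moreover have "transpose ?F *v w = transpose A *v w"
      using QZw tZ tQ by (simp add: transpose_distribs matrix_vector_distribs matrix_vector_mul_assoc[symmetric])
    ultimately show ?thesis using Sw by simp
  qed
  have "K *v (((*v) (transpose A) ^^ k) v) = 0" for k
    using K step by (induction k) (simp_all add: K_def)
  then have "v = 0" by (rule ctrl[OF step[THEN conjunct1]])
  with v show False by simp
qed

lemma dual_subsolution_le_solution:
  assumes "antistable (A + Z ** Q)" "transpose Z = Z" "transpose V = V" "pos_semidef Q"
    and "dual_residual A M Q Z = 0" "pos_semidef (- dual_residual A M Q V)"
  shows "psd_le V Z"
  unfolding psd_le_def
proof (rule antistableD[OF assms(1)])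
  have tQ: "transpose Q = Q" using assms by (simp add: pos_semidef_def)
  show "pos_semidef ((A + Z ** Q) ** (Z - V) + (Z - V) ** transpose (A + Z ** Q))"
    unfolding dual_residual_diff[OF tQ assms(2,3), of A M]
    using pos_semidef_add[OF pos_semidef_sandwich[OF assms(4), of "Z - V"] assms(6)] assms
    by (simp add: transpose_distribs)
qed (use assms in \<open>simp add: transpose_distribs\<close>)

text \<open>The step aims at the residual \<open>e I\<close> instead of 0. This strictness makes the
  Lyapunov image of \<open>Z' - V0\<close> definite, first for the old matrix
  \<open>A + Z ** Q\<close> and then for the new one, so antistability is passed on. The iterate
  decreases once the old residual is at least \<open>e I\<close>.\<close>

lemma Newton_step:
  fixes A M Q Z :: "real^'k^'k"
  assumes Q: "pos_semidef Q" and M: "transpose M = M"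
    and Z: "transpose Z = Z" "antistable (A + Z ** Q)" and e: "e > 0"
    and V0: "transpose V0 = V0" "pos_semidef (- dual_residual A M Q V0)"
  obtains Z' where "transpose Z' = Z'" "antistable (A + Z' ** Q)"
    "dual_residual A M Q Z' = (Z' - Z) ** Q ** (Z' - Z) + e *\<^sub>R mat 1"
    "\<And>V. transpose V = V \<Longrightarrow> pos_semidef (- dual_residual A M Q V) \<Longrightarrow> psd_le V Z'"
    "pos_semidef (dual_residual A M Q Z - e *\<^sub>R mat 1) \<Longrightarrow> psd_le Z' Z"
proof -
  let ?R = "dual_residual A M Q" and ?F = "A + Z ** Q" and ?I = "e *\<^sub>R mat 1 :: real^'k^'k"
  have tQ: "transpose Q = Q" using Q by (simp add: pos_semidef_def)
  have I: "pos_def ?I" using e by (intro pos_def_scaleR pos_def_mat_1)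
  have tI: "transpose ?I = ?I" by (simp add: transpose_distribs)
  have "transpose (Z ** Q ** Z + M + ?I) = Z ** Q ** Z + M + ?I"
    using Z(1) tQ M tI by (simp add: transpose_distribs matrix_mul_assoc)
  from lyapunov_equation_solvable[OF Z(2) this]
  obtain Z' where Z': "transpose Z' = Z'" "?F ** Z' + Z' ** transpose ?F = Z ** Q ** Z + M + ?I"
    by blast
  note N = dual_residual_Newton[OF tQ Z(1) Z']
  have lyapV: "pos_def (?F ** (Z' - V) + (Z' - V) ** transpose ?F)"
    if "transpose V = V" "pos_semidef (- ?R V)" for V
  proof -
    have "pos_semidef ((Z - V) ** Q ** (Z - V) + - ?R V)"
      using that Z(1) by (intro pos_semidef_add pos_semidef_sandwich[OF Q]) (simp_all only: transpose_diff)
    from pos_def_add_pos_semidef[OF this I]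
    show ?thesis by (simp only: N(1)[OF that(1)] add_uminus_conv_diff)
  qed
  have dom: "psd_le V Z'" if "transpose V = V" "pos_semidef (- ?R V)" for V
    unfolding psd_le_def
    by (rule antistableD[OF Z(2) _ pos_def_imp_pos_semidef[OF lyapV[OF that]]])
      (simp only: transpose_diff that Z'(1))
  have W: "pos_semidef (Z' - V0)" using dom[OF V0] by (simp add: psd_le_def)
  have tW: "transpose (Z' - V0) = Z' - V0" using W by (simp add: pos_semidef_def)
  \<comment> \<open>A kernel vector of the semidefinite \<open>Z' - V0\<close> would annihilate its
    Lyapunov form, which is positive definite.\<close>
  have H: "pos_def (Z' - V0)"
    unfolding pos_def_def
  proof (intro conjI tW allI impI)
    fix x :: "real^'k"
    assume "x \<noteq> 0"
    then have "0 < x \<bullet> ((?F ** (Z' - V0) + (Z' - V0) ** transpose ?F) *v x)"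
      using lyapV[OF V0] unfolding pos_def_def by blast
    then have "(Z' - V0) *v x \<noteq> 0" using lyapunov_kernel[OF tW, of x ?F] by linarith
    then have "x \<bullet> ((Z' - V0) *v x) \<noteq> 0" using pos_semidef_kernel[OF W] by blast
    then show "0 < x \<bullet> ((Z' - V0) *v x)" using pos_semidefD[OF W, of x] by linarith
  qed
  have "pos_semidef ((Z' - V0) ** Q ** (Z' - V0) + ((Z' - Z) ** Q ** (Z' - Z) + - ?R V0))"
    using V0 Z(1) Z'(1)
    by (intro pos_semidef_add pos_semidef_sandwich[OF Q]) (simp_all only: transpose_diff)
  then have "pos_def ((Z' - V0) ** Q ** (Z' - V0) + ((Z' - Z) ** Q ** (Z' - Z) + - ?R V0) + ?I)"
    using I by (rule pos_def_add_pos_semidef)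
  then have "pos_def ((A + Z' ** Q) ** (Z' - V0) + (Z' - V0) ** transpose (A + Z' ** Q))"
    unfolding dual_residual_diff[OF tQ Z'(1) V0(1), of A M] N(2) by (simp add: algebra_simps)
  then have as: "antistable (A + Z' ** Q)" by (rule antistable_if_lyapunov_pos_def[OF H])
  have mono: "psd_le Z' Z" if "pos_semidef (?R Z - ?I)"
    unfolding psd_le_def
  proof (rule antistableD[OF Z(2)])
    have "?F ** (Z - Z') + (Z - Z') ** transpose ?F
        = - (?F ** (Z' - Z) + (Z' - Z) ** transpose ?F)"
      by (simp add: matrix_distribs algebra_simps)
    also have "\<dots> = ?R Z - ?I" unfolding N(1)[OF Z(1)] by (simp add: matrix_zero_left)
    finally show "pos_semidef (?F ** (Z - Z') + (Z - Z') ** transpose ?F)" using that by simp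
  qed (use Z Z' in \<open>simp add: transpose_distribs\<close>)
  show thesis by (rule that[OF Z'(1) as N(2) dom mono])
qed

lemma tendsto_matrix_mult:
  fixes X :: "'z \<Rightarrow> real^'b^'a" and Y :: "'z \<Rightarrow> real^'c^'b"
  assumes "(X \<longlongrightarrow> K) F" "(Y \<longlongrightarrow> L) F"
  shows "((\<lambda>n. X n ** Y n) \<longlongrightarrow> K ** L) F"
  unfolding matrix_matrix_mult_def
  by (intro vec_tendstoI) (simp, intro tendsto_sum tendsto_mult tendsto_vec_nth assms)

lemma tendsto_quadratic_form:
  fixes Z :: "nat \<Rightarrow> real^'k^'k"
  assumes "Z \<longlonglongrightarrow> L"
  shows "(\<lambda>n. x \<bullet> (Z n *v x)) \<longlonglongrightarrow> x \<bullet> (L *v x)"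
proof -
  have "(\<lambda>n. Z n *v x) \<longlonglongrightarrow> L *v x"
    unfolding matrix_vector_mult_def
    by (intro vec_tendstoI) (simp, intro tendsto_sum tendsto_mult tendsto_vec_nth tendsto_const assms)
  then show ?thesis by (intro tendsto_inner tendsto_const)
qed

lemma tendsto_transpose:
  fixes Z :: "nat \<Rightarrow> real^'k^'k"
  assumes "Z \<longlonglongrightarrow> L"
  shows "(\<lambda>n. transpose (Z n)) \<longlonglongrightarrow> transpose L"
  unfolding transpose_def by (intro vec_tendstoI) (simp, intro tendsto_vec_nth assms)

lemma psd_le_quadratic_form:
  "psd_le X Y \<Longrightarrow> x \<bullet> (X *v x) \<le> x \<bullet> (Y *v x)"
  using pos_semidefD[of "Y - X" x] by (simp add: psd_le_def matrix_vector_distribs inner_diff_right)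

lemma inner_axis_matrix: "axis i 1 \<bullet> ((X::real^'k^'k) *v axis j 1) = X $ i $ j"
  by (simp add: inner_axis' matrix_vector_mult_basis column_def)

text \<open>Each quadratic form is a decreasing bounded real sequence; polarization recovers the
  matrix entries from them.\<close>

lemma psd_decreasing_convergent:
  fixes Z :: "nat \<Rightarrow> real^'k^'k"
  assumes sym: "\<And>n. transpose (Z n) = Z n"
    and dec: "\<And>n. psd_le (Z (Suc n)) (Z n)"
    and bound: "\<And>n. psd_le V (Z n)"
  obtains L where "Z \<longlonglongrightarrow> L"
proof -
  define q where "q x n = x \<bullet> (Z n *v x)" for x n
  have conv: "convergent (q x)" for x
  proof -
    have "decseq (q x)"
      unfolding q_def by (intro decseq_SucI psd_le_quadratic_form dec)
    moreover have "x \<bullet> (V *v x) \<le> q x n" for n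
      unfolding q_def by (intro psd_le_quadratic_form bound)
    ultimately show ?thesis
      by (metis decseq_convergent convergent_def)
  qed
  have polar: "Z n $ i $ j = (q (axis i 1 + axis j 1) n - q (axis i 1) n - q (axis j 1) n) / 2" for n i j
  proof -
    have "Z n $ j $ i = Z n $ i $ j"
      using sym[of n] by (metis transpose_def vec_lambda_beta)
    then show ?thesis
      by (simp add: q_def matrix_vector_right_distrib inner_distrib inner_axis_matrix)
  qed
  have "convergent (\<lambda>n. Z n $ i $ j)" for i j
    unfolding polar divide_inverse by (intro convergent_mult convergent_diff convergent_const conv)
  then obtain l where l: "\<And>i j. (\<lambda>n. Z n $ i $ j) \<longlonglongrightarrow> l i j"
    unfolding convergent_def by metis
  have "Z \<longlonglongrightarrow> (\<chi> i j. l i j)"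
    by (intro vec_tendstoI) (simp add: l)
  then show thesis by (rule that)
qed

text \<open>The perturbations \<open>(1 / (n + 1)) I\<close> keep every Newton iterate strictly antistable, although
  the limit may be only marginally so.\<close>

proposition greatest_dual_solution:
  fixes A M Q Z0 V0 :: "real^'k^'k"
  assumes Q: "pos_semidef Q" and M: "transpose M = M"
    and Z0: "transpose Z0 = Z0" "antistable (A + Z0 ** Q)"
    and V0: "transpose V0 = V0" "pos_semidef (- dual_residual A M Q V0)"
  obtains Z where "transpose Z = Z" "dual_residual A M Q Z = 0"
    "\<And>V. transpose V = V \<Longrightarrow> pos_semidef (- dual_residual A M Q V) \<Longrightarrow> psd_le V Z"
proof -
  let ?R = "dual_residual A M Q"
  define sub where "sub V \<longleftrightarrow> transpose V = V \<and> pos_semidef (- ?R V)" for V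
  define E where "E n = inverse (real (Suc n)) *\<^sub>R (mat 1 :: real^'k^'k)" for n
  define P where "P n Z \<longleftrightarrow> transpose Z = Z \<and> antistable (A + Z ** Q)
      \<and> (\<forall>V. sub V \<longrightarrow> psd_le V Z) \<and> pos_semidef (?R Z - E n)" for n Z
  define S where "S n Z Z' \<longleftrightarrow> psd_le Z' Z \<and> ?R Z' = (Z' - Z) ** Q ** (Z' - Z) + E (Suc n)" for n Z Z'
  have sandwich: "pos_semidef ((Z' - Z) ** Q ** (Z' - Z))"
    if "transpose Z = Z" "transpose Z' = Z'" for Z Z'
    by (rule pos_semidef_sandwich[OF Q]) (simp only: transpose_diff that)
  \<comment> \<open>Nothing is known about the residual at \<open>Z0\<close>. One step makes it at
    least \<open>E 0\<close>, and only from there on do the iterates decrease.\<close>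
  have "\<exists>Z. P 0 Z"
  proof -
    obtain Z where Z: "transpose Z = Z" "antistable (A + Z ** Q)"
      "?R Z = (Z - Z0) ** Q ** (Z - Z0) + inverse (real (Suc 0)) *\<^sub>R mat 1"
      "\<And>V. transpose V = V \<Longrightarrow> pos_semidef (- ?R V) \<Longrightarrow> psd_le V Z"
      using Newton_step[OF Q M Z0 _ V0, of "inverse (real (Suc 0))"] by auto
    then have "P 0 Z" using sandwich[OF Z0(1) Z(1)] unfolding P_def sub_def E_def by simp
    then show ?thesis ..
  qed
  moreover have "\<exists>Z'. P (Suc n) Z' \<and> S n Z Z'" if PZ: "P n Z" for n Z
  proof -
    have Z: "transpose Z = Z" "antistable (A + Z ** Q)" "pos_semidef (?R Z - E n)"
      using PZ by (simp_all add: P_def)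
    have e: "inverse (real (Suc (Suc n))) > 0" by simp
    \<comment> \<open>Since the perturbations decrease, the residual also dominates the next one, as
      the monotonicity clause of \<open>Newton_step\<close> demands.\<close>
    have "pos_semidef ((?R Z - E n)
        + (inverse (real (Suc n)) - inverse (real (Suc (Suc n)))) *\<^sub>R mat 1)"
      by (intro pos_semidef_add Z(3) pos_semidef_scaleR pos_def_imp_pos_semidef pos_def_mat_1)
        (simp add: field_simps)
    then have le: "pos_semidef (?R Z - inverse (real (Suc (Suc n))) *\<^sub>R mat 1)"
      by (simp add: E_def scaleR_diff_left)
    obtain Z' where Z': "transpose Z' = Z'" "antistable (A + Z' ** Q)"
      "?R Z' = (Z' - Z) ** Q ** (Z' - Z) + inverse (real (Suc (Suc n))) *\<^sub>R mat 1"
      "\<And>V. transpose V = V \<Longrightarrow> pos_semidef (- ?R V) \<Longrightarrow> psd_le V Z'" "psd_le Z' Z"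
      using Newton_step[OF Q M Z(1,2) e V0] le by metis
    then have "P (Suc n) Z' \<and> S n Z Z'"
      using sandwich[OF Z(1) Z'(1)] unfolding P_def S_def sub_def E_def by simp
    then show ?thesis ..
  qed
  ultimately obtain Z where PZ: "\<And>n. P n (Z n)" and SZ: "\<And>n. S n (Z n) (Z (Suc n))"
    using dependent_nat_choice[of P S] by blast
  have tZ: "transpose (Z n) = Z n" for n using PZ by (simp add: P_def)
  have dom: "psd_le V (Z n)" if "sub V" for V n using PZ that by (simp add: P_def)
  have "sub V0" using V0 by (simp add: sub_def)
  then obtain L where L: "Z \<longlonglongrightarrow> L"
    using psd_decreasing_convergent[of Z V0] tZ SZ dom unfolding S_def by blast
  have tL: "transpose L = L"
    using LIMSEQ_unique[OF tendsto_transpose[OF L]] L tZ by simp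
  have L': "(\<lambda>n. Z (Suc n)) \<longlonglongrightarrow> L" using L by (rule LIMSEQ_Suc)
  have E0: "(\<lambda>n. E (Suc n)) \<longlonglongrightarrow> 0 *\<^sub>R mat 1"
    unfolding E_def
    by (intro tendsto_scaleR tendsto_const LIMSEQ_Suc LIMSEQ_inverse_real_of_nat)
  have "(\<lambda>n. ?R (Z (Suc n))) \<longlonglongrightarrow> ?R L"
    unfolding dual_residual_def
    by (intro tendsto_add tendsto_diff tendsto_matrix_mult tendsto_const L')
  \<comment> \<open>Consecutive iterates share the limit \<open>L\<close>, so the Newton remainder
    and the perturbation both tend to 0.\<close>
  moreover have "(\<lambda>n. ?R (Z (Suc n))) \<longlonglongrightarrow> (L - L) ** Q ** (L - L) + 0 *\<^sub>R mat 1"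
    using SZ unfolding S_def
    by (simp only:) (intro tendsto_add tendsto_diff tendsto_matrix_mult tendsto_const L L' E0)
  ultimately have "?R L = 0" using LIMSEQ_unique by (fastforce simp: matrix_zero_left)
  moreover have "psd_le V L" if V: "sub V" for V
    unfolding psd_le_def pos_semidef_def
  proof (intro conjI allI)
    show "transpose (L - V) = L - V" using tL V by (simp add: transpose_diff sub_def)
    fix x
    have "x \<bullet> (V *v x) \<le> x \<bullet> (L *v x)"
      by (rule LIMSEQ_le_const[OF tendsto_quadratic_form[OF L]])
        (use dom[OF V] psd_le_quadratic_form in blast)
    then show "0 \<le> x \<bullet> ((L - V) *v x)"
      by (simp add: matrix_vector_mult_diff_rdistrib inner_diff_right)
  qed
  ultimately show thesis by (intro that[of L] tL) (simp_all add: sub_def)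
qed

section \<open>Passing between Riccati solutions and dual solutions\<close>

lemma matrix_inv_involution:
  assumes "pos_def (X::real^'k^'k)"
  shows "matrix_inv (matrix_inv X) = X"
  using pos_def_inverse[OF assms] pos_def_inverse(1,2)[OF pos_def_inverse(3)[OF assms]]
  by (metis matrix_mul_assoc matrix_mul_lid matrix_mul_rid)

lemma dual_residual_matrix_inv:
  fixes A M Q X :: "real^'k^'k"
  assumes "pos_def X" "riccati_eq A M Q X"
  shows "dual_residual A M Q (matrix_inv X) = 0"
proof -
  let ?Z = "matrix_inv X"
  note inv = pos_def_inverse(1,2)[OF assms(1)]
  have XZ: "P ** X ** ?Z = P" and ZX: "P ** ?Z ** X = P" for P :: "real^'k^'k"
    by (simp_all add: matrix_mul_assoc[symmetric] inv)
  have "?Z ** (transpose A ** X + X ** A - X ** M ** X + Q) ** ?Z = 0"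
    using assms(2) by (simp add: riccati_eq_def matrix_zero_left matrix_zero_right)
  then show ?thesis
    by (simp add: dual_residual_def matrix_distribs matrix_mul_assoc XZ ZX inv algebra_simps)
qed

lemma riccati_eq_matrix_inv:
  fixes A M Q Z :: "real^'k^'k"
  assumes "pos_def Z" "dual_residual A M Q Z = 0"
  shows "riccati_eq A M Q (matrix_inv Z)"
proof -
  let ?X = "matrix_inv Z"
  note inv = pos_def_inverse(1,2)[OF assms(1)]
  have XZ: "P ** Z ** ?X = P" and ZX: "P ** ?X ** Z = P" for P :: "real^'k^'k"
    by (simp_all add: matrix_mul_assoc[symmetric] inv)
  have "?X ** (A ** Z + Z ** transpose A + Z ** Q ** Z - M) ** ?X = 0"
    using assms(2) by (simp add: dual_residual_def matrix_zero_left matrix_zero_right)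
  then show ?thesis
    by (simp add: riccati_eq_def matrix_distribs matrix_mul_assoc XZ ZX inv algebra_simps)
qed

text \<open>Antistability at \<open>matrix_inv X\<close> is not known, so the direct comparison
  \<open>dual_subsolution_le_solution\<close> does not apply. Instead the greatest dual solution
  lies above \<open>matrix_inv X\<close>, hence is definite, and its inverse solves the Riccati
  equation; minimality of \<open>X\<close> then forces equality.\<close>

lemma minimal_solution_inverse_greatest:
  fixes A M Q X Z0 V :: "real^'k^'k"
  assumes Q: "pos_semidef Q" and M: "transpose M = M"
    and Z0: "transpose Z0 = Z0" "antistable (A + Z0 ** Q)"
    and X: "minimal_pd_solution (riccati_eq A M Q) X"
    and V: "transpose V = V" "pos_semidef (- dual_residual A M Q V)"
  shows "psd_le V (matrix_inv X)"
proof -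
  have pX: "pos_def X" and rX: "riccati_eq A M Q X"
    using X by (simp_all add: minimal_pd_solution_def)
  have res: "dual_residual A M Q (matrix_inv X) = 0"
    by (rule dual_residual_matrix_inv[OF pX rX])
  have tX: "transpose (matrix_inv X) = matrix_inv X"
    using pos_def_inverse(3)[OF pX] by (simp add: pos_def_def)
  obtain Z where Z: "transpose Z = Z" "dual_residual A M Q Z = 0"
    and great: "\<And>V. transpose V = V \<Longrightarrow> pos_semidef (- dual_residual A M Q V) \<Longrightarrow> psd_le V Z"
    using greatest_dual_solution[OF Q M Z0 V] by blast
  have "psd_le (matrix_inv X) Z"
    by (rule great[OF tX]) (simp add: res pos_semidef_zero)
  then have "pos_def Z"
    using pos_def_add_pos_semidef[of "Z - matrix_inv X" "matrix_inv X"] pos_def_inverse(3)[OF pX]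
    by (simp add: psd_le_def)
  then have "psd_le X (matrix_inv Z)"
    using X riccati_eq_matrix_inv Z pos_def_inverse(3) unfolding minimal_pd_solution_def by blast
  then have "psd_le Z (matrix_inv X)"
    using pos_def_psd_le_inverse[OF pX pos_def_inverse(3)] matrix_inv_involution \<open>pos_def Z\<close> by metis
  with great[OF V] show ?thesis by (rule psd_le_trans)
qed

section \<open>Kronecker products and compression to eigenvectors of the matrix of ones\<close>

lemma sum_UNIV_prod:
  "(\<Sum>p\<in>(UNIV :: ('a::finite \<times> 'b::finite) set). f p) = (\<Sum>i\<in>UNIV. \<Sum>a\<in>UNIV. f (i, a))"
  by (simp add: sum.cartesian_product UNIV_Times_UNIV[symmetric] del: UNIV_Times_UNIV)

lemma kron_mult:
  fixes M :: "real^'b^'a" and N :: "real^'e^'d"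
  shows "kron M N ** kron M' N' = kron (M ** M') (N ** N')"
  by (simp add: vec_eq_iff kron_def matrix_matrix_mult_def sum_UNIV_prod sum_product algebra_simps)

lemma kron_add_right: "kron M (N + N') = kron M N + kron M N'"
  by (simp add: vec_eq_iff kron_def algebra_simps)

lemma kron_diff_right: "kron M (N - N') = kron M N - kron M N'"
  by (simp add: vec_eq_iff kron_def algebra_simps)

lemma kron_scaleR_left: "kron (c *\<^sub>R M) N = c *\<^sub>R kron M N"
  by (simp add: vec_eq_iff kron_def)

lemma kron_zero_right: "kron M 0 = 0"
  by (simp add: vec_eq_iff kron_def)

lemma kron_mat_1: "kron (mat 1) (mat 1) = mat 1"
  by (auto simp: vec_eq_iff kron_def mat_def prod_eq_iff)

lemma transpose_kron: "transpose (kron M N) = kron (transpose M) (transpose N)"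
  by (simp add: vec_eq_iff kron_def transpose_def)

lemma transpose_ones_mat: "transpose ones_mat = ones_mat"
  by (simp add: vec_eq_iff ones_mat_def transpose_def)

lemma trace_kron: "trace (kron M N) = trace M * trace N"
  by (simp add: trace_def kron_def sum_UNIV_prod sum_product)

lemma trace_scaleR: "trace (c *\<^sub>R (X::real^'k^'k)) = c * trace X"
  by (simp add: trace_def sum_distrib_left)

lemma trace_ones_mat: "trace (ones_mat :: real^'n^'n) = real CARD('n)"
  by (simp add: trace_def ones_mat_def)

lemma ones_mat_square: "(ones_mat :: real^'n^'n) ** ones_mat = real CARD('n) *\<^sub>R ones_mat"
  by (simp add: vec_eq_iff ones_mat_def matrix_matrix_mult_def)

text \<open>\<open>lift w\<close> is the matrix of \<open>u \<mapsto> w \<otimes> u\<close>, that is, the Kronecker product of the column \<open>w\<close>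
  with the identity.\<close>

definition lift :: "real^'n \<Rightarrow> real^'d^('n \<times> 'd)" where
  "lift w = (\<chi> p k. w $ fst p * (if snd p = k then 1 else 0))"

lemma sum_if_const: "(\<Sum>n\<in>A. if P then f n else 0) = (if P then sum f A else 0)"
  by simp

lemma kron_lift: "kron M T ** lift w = lift (M *v w) ** T"
  by (simp add: vec_eq_iff kron_def lift_def matrix_matrix_mult_def matrix_vector_mult_def
      sum_UNIV_prod if_distrib[where f = "\<lambda>x. _ * x"] if_distrib[where f = "\<lambda>x. x * _"]
      sum_if_const sum_distrib_left sum_distrib_right algebra_simps cong: if_cong)

lemma kron_mat_1_lift: "kron (mat 1) T ** lift w = lift w ** T"
  by (simp add: kron_lift)

lemma lift_kron_mat_1: "transpose (lift w) ** kron (mat 1) T = T ** transpose (lift w)"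
  using arg_cong[OF kron_mat_1_lift[of "transpose T" w], of transpose]
  by (simp add: matrix_transpose_mul transpose_kron)

lemma lift_orthonormal:
  fixes w :: "real^'n"
  assumes "norm w = 1"
  shows "transpose (lift w) ** lift w = (mat 1 :: real^'d^'d)"
proof -
  have "(\<Sum>i\<in>UNIV. w $ i * w $ i) = 1"
    using assms by (simp add: norm_eq_1 inner_vec_def)
  then show ?thesis
    by (auto simp: vec_eq_iff transpose_def lift_def mat_def matrix_matrix_mult_def sum_UNIV_prod
        if_distrib[where f = "\<lambda>x. _ * x"] if_distrib[where f = "\<lambda>x. x * _"] cong: if_cong)
qed

lemma lift_add: "lift (v + w) = lift v + lift w"
  by (simp add: vec_eq_iff lift_def algebra_simps)

lemma lift_scaleR: "lift (c *\<^sub>R w) = c *\<^sub>R lift w"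
  by (simp add: vec_eq_iff lift_def)

lemma lift_zero: "lift 0 = 0"
  by (simp add: vec_eq_iff lift_def)

lemma mult_lift_axis: "((T :: real^('n::finite \<times> 'd::finite)^'k) ** lift (axis j 1)) $ p $ k = T $ p $ (j, k)"
  by (simp add: lift_def matrix_matrix_mult_def sum_UNIV_prod axis_def
      if_distrib[where f = "\<lambda>x. _ * x"] if_distrib[where f = "\<lambda>x. x * _"] cong: if_cong)

lemma lift_axis_component: "(transpose (lift (axis j 1)) *v x) $ k = x $ (j, k)"
  by (simp add: lift_def transpose_def matrix_vector_mult_def sum_UNIV_prod axis_def
      if_distrib[where f = "\<lambda>x. _ * x"] if_distrib[where f = "\<lambda>x. x * _"] cong: if_cong)

lemma lift_axis_separating:
  assumes "\<And>j. transpose (lift (axis j 1)) *v x = 0"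
  shows "x = 0"
  using assms lift_axis_component[of _ x] by (metis prod.collapse vec_eq_iff zero_index)

text \<open>Each coordinate vector is the sum of its mean part, a multiple of the ones vector, and a
  vector with coordinate sum 0; these are eigenvectors for n and 0.\<close>

lemma zero_on_eigenvectors_of_ones_mat:
  fixes T :: "real^('n::finite \<times> 'd::finite)^'k"
  assumes T: "\<And>w s. norm w = 1 \<Longrightarrow> (ones_mat :: real^'n^'n) *v w = s *\<^sub>R w \<Longrightarrow>
      s = 0 \<or> s = real CARD('n) \<Longrightarrow> T ** lift w = 0"
  shows "T = 0"
proof -
  have zero: "T ** lift w = 0"
    \<comment> \<open>The case \<open>w = 0\<close> does occur: for a single agent the part with
      coordinate sum 0 vanishes.\<close>
    if "(ones_mat :: real^'n^'n) *v w = s *\<^sub>R w" "s = 0 \<or> s = real CARD('n)" for w s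
  proof (cases "w = 0")
    case True
    then show ?thesis by (simp add: lift_zero matrix_zero_right)
  next
    case False
    have "T ** lift ((1 / norm w) *\<^sub>R w) = 0"
      using False that by (intro T[of _ s]) (simp_all add: matrix_vector_mult_scaleR)
    then show ?thesis using False by (simp add: lift_scaleR matrix_scaleR_right)
  qed
  let ?n = "real CARD('n)" and ?e = "\<chi> i. 1 :: real^'n"
  have ones: "(ones_mat :: real^'n^'n) *v x = (\<Sum>i\<in>UNIV. x $ i) *\<^sub>R ?e" for x
    by (simp add: vec_eq_iff ones_mat_def matrix_vector_mult_def)
  have "T ** lift (axis j 1) = 0" for j
  proof -
    let ?w = "axis j 1 - (1 / ?n) *\<^sub>R ?e"
    have "T ** lift ?w = 0"
      by (rule zero[of _ 0]) (simp_all add: ones sum_subtractf axis_def)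
    moreover have "T ** lift ?e = 0"
      by (rule zero[of _ ?n]) (simp_all add: ones)
    moreover have "(lift (axis j 1) :: real^'d^('n \<times> 'd)) = lift ?w + (1 / ?n) *\<^sub>R lift ?e"
      by (simp add: lift_add[symmetric] lift_scaleR[symmetric])
    ultimately show ?thesis by (simp add: matrix_add_ldistrib matrix_scaleR_right)
  qed
  then show ?thesis by (simp add: vec_eq_iff mult_lift_axis[symmetric])
qed

lemma pos_semidef_kron_mat_1:
  fixes T :: "real^'d^'d"
  assumes "pos_semidef T"
  shows "pos_semidef (kron (mat 1 :: real^'n::finite^'n) T)"
proof -
  have "x \<bullet> (kron (mat 1 :: real^'n^'n) T *v x)
      = (\<Sum>i\<in>UNIV. (transpose (lift (axis i 1)) *v x) \<bullet> (T *v (transpose (lift (axis i 1)) *v x)))" for x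
    by (simp add: matrix_vector_mul_assoc lift_kron_mat_1[symmetric])
      (simp add: matrix_vector_mul_assoc[symmetric] inner_vec_def[of "transpose _ *v _"]
        lift_axis_component inner_vec_def[of x] sum_UNIV_prod)
  then show ?thesis
    using assms by (simp add: pos_semidef_def transpose_kron sum_nonneg)
qed

lemma pos_def_kron_mat_1:
  fixes T :: "real^'d^'d"
  assumes "pos_def T"
  shows "pos_def (kron (mat 1 :: real^'n::finite^'n) T)"
proof -
  let ?K = "kron (mat 1 :: real^'n^'n) T"
  have psd: "pos_semidef ?K"
    by (intro pos_semidef_kron_mat_1 pos_def_imp_pos_semidef assms)
  have "kron (mat 1) (matrix_inv T) ** ?K = mat 1"
    by (simp add: kron_mult pos_def_inverse[OF assms] kron_mat_1)
  then have inj: "x = 0" if "?K *v x = 0" for x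
    using that by (metis matrix_vector_mul_assoc matrix_vector_mul_lid matrix_vector_mult_0_right)
  have "0 < x \<bullet> (?K *v x)" if "x \<noteq> 0" for x
    using that inj[of x] pos_semidefD[OF psd, of x] pos_semidef_kernel[OF psd, of x]
    by (cases "x \<bullet> (?K *v x) = 0") auto
  then show ?thesis using psd by (simp add: pos_def_def pos_semidef_def)
qed

text \<open>\<open>P\<close> is the orthogonal projection onto the complement of the range of
  \<open>lift w\<close>. It commutes with \<open>kron (mat 1) T\<close>, so there are no cross
  terms.\<close>

lemma kron_mat_1_pinching:
  fixes w :: "real^'n" and T :: "real^'d^'d"
  assumes "norm w = 1"
  defines "P \<equiv> mat 1 - lift w ** transpose (lift w)"
  shows "kron (mat 1) T = transpose P ** kron (mat 1) T ** P + lift w ** T ** transpose (lift w)"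
proof -
  let ?L = "lift w :: real^'d^('n \<times> 'd)" and ?K = "kron (mat 1) T :: real^('n \<times> 'd)^('n \<times> 'd)"
  have LL: "Y ** transpose ?L ** ?L = Y" for Y :: "real^'d^('n \<times> 'd)"
    using lift_orthonormal[OF assms(1), where 'd = 'd] by (simp add: matrix_mul_assoc[symmetric])
  have KL: "?K ** ?L = ?L ** T" by (rule kron_mat_1_lift)
  have LK: "Y ** transpose ?L ** ?K = Y ** T ** transpose ?L" for Y :: "real^'d^('n \<times> 'd)"
    using lift_kron_mat_1[of w T] by (simp add: matrix_mul_assoc[symmetric])
  show ?thesis
    by (simp add: P_def transpose_distribs matrix_distribs matrix_mul_assoc KL LK LL)
qed

text \<open>The linear and constant terms compress exactly. By pinching, the quadratic term
  compresses to that of the compressed \<open>Z\<close> plus a semidefinite matrix, so the residual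
  can only drop.\<close>

lemma dual_residual_compress:
  fixes w :: "real^'n" and A Q Mw :: "real^'d^'d"
  assumes w: "norm w = 1" and Q: "pos_semidef Q"
    and M: "M ** lift w = lift w ** Mw"
    and Z: "transpose Z = Z"
    and R: "pos_semidef (- dual_residual (kron (mat 1) A) M (kron (mat 1) Q) Z)"
  shows "pos_semidef (- dual_residual A Mw Q (transpose (lift w) ** Z ** lift w))"
proof -
  let ?L = "lift w :: real^'d^('n \<times> 'd)"
  let ?A = "kron (mat 1) A :: real^('n \<times> 'd)^('n \<times> 'd)"
  let ?Q = "kron (mat 1) Q :: real^('n \<times> 'd)^('n \<times> 'd)"
  define P where "P = mat 1 - ?L ** transpose ?L"
  define C where "C = transpose P ** ?Q ** P"
  have LL: "transpose ?L ** ?L = mat 1" by (rule lift_orthonormal[OF w])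
  have C: "pos_semidef C"
    unfolding C_def by (intro pos_semidef_congruence pos_semidef_kron_mat_1 Q)
  have QC: "?Q = C + ?L ** Q ** transpose ?L"
    unfolding C_def P_def by (rule kron_mat_1_pinching[OF w])
  have AL: "transpose ?A ** ?L = ?L ** transpose A"
    by (simp add: transpose_kron kron_mat_1_lift)
  have LA: "transpose ?L ** ?A = A ** transpose ?L" by (rule lift_kron_mat_1)
  have "transpose ?L ** dual_residual ?A M ?Q Z ** ?L
      = (transpose ?L ** ?A) ** Z ** ?L + transpose ?L ** Z ** (transpose ?A ** ?L)
        + transpose ?L ** Z ** ?Q ** Z ** ?L - transpose ?L ** (M ** ?L)"
    by (simp add: dual_residual_def matrix_distribs matrix_mul_assoc)
  also have "\<dots> = dual_residual A Mw Q (transpose ?L ** Z ** ?L)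
      + transpose (Z ** ?L) ** C ** (Z ** ?L)"
    unfolding AL LA M QC
    by (simp add: dual_residual_def matrix_distribs matrix_mul_assoc LL Z matrix_transpose_mul)
  finally have eq: "- dual_residual A Mw Q (transpose ?L ** Z ** ?L)
      = transpose (Z ** ?L) ** C ** (Z ** ?L) + transpose ?L ** (- dual_residual ?A M ?Q Z) ** ?L"
    by (simp add: matrix_distribs algebra_simps
        matrix_diff_ldistrib[of "transpose ?L" 0, simplified matrix_zero_right, simplified]
        matrix_diff_rdistrib[of 0, simplified matrix_zero_left, simplified])
  show ?thesis
    unfolding eq by (intro pos_semidef_add pos_semidef_congruence C R)
qed

section \<open>Controllability as a kernel condition, and block matrices\<close>

lemma matrix_inv_unique:
  fixes X Y :: "real^'k^'k"
  assumes "X ** Y = mat 1"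
  shows "matrix_inv X = Y"
proof -
  have "Y ** X = mat 1" using assms by (simp add: matrix_left_right_inverse)
  with assms have "\<exists>X'. X ** X' = mat 1 \<and> X' ** X = mat 1" by blast
  then have "matrix_inv X ** X = mat 1"
    unfolding matrix_inv_def by (rule someI_ex[THEN conjunct2])
  then have "matrix_inv X ** (X ** Y) = Y" by (simp add: matrix_mul_assoc)
  then show ?thesis by (simp add: assms)
qed

text \<open>The entries of \<open>B' (A')^k v\<close> are the inner products of \<open>v\<close>
  with the columns of \<open>A^k B\<close>, and these columns span the whole space.\<close>

lemma controllable_imp_kernel_zero:
  fixes A :: "real^'d^'d" and B :: "real^'m^'d"
  assumes ctrl: "controllable A B"
    and zero: "\<And>k. transpose B *v (((*v) (transpose A) ^^ k) v) = 0"
  shows "v = 0"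
proof -
  let ?S = "\<Union>k<CARD('d). columns (((\<lambda>M. A ** M) ^^ k) B)"
  have shift: "transpose (((\<lambda>M. A ** M) ^^ k) B) *v u = transpose B *v (((*v) (transpose A) ^^ k) u)"
    for k u
    by (induction k arbitrary: u)
      (simp_all add: matrix_transpose_mul matrix_vector_mul_assoc[symmetric]
        funpow_swap1[of "(*v) (transpose A)"])
  have "orthogonal v c" if c_in: "c \<in> ?S" for c
  proof -
    obtain k i where c: "c = column i (((\<lambda>M. A ** M) ^^ k) B)"
      using c_in unfolding columns_def by blast
    have "c \<bullet> v = (transpose (((\<lambda>M. A ** M) ^^ k) B) *v v) $ i"
      unfolding c by (simp add: matrix_vector_mul_component column_def transpose_def)
    also have "\<dots> = 0" by (simp add: shift zero)
    finally show ?thesis by (simp add: orthogonal_def inner_commute)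
  qed
  moreover have "span ?S = UNIV"
    using ctrl unfolding controllable_def by (subst dim_eq_full[symmetric]) simp
  ultimately have "orthogonal v v" by (intro orthogonal_to_span[of v ?S v]) auto
  then show ?thesis by (simp add: orthogonal_def)
qed

lemma pos_def_congruence_kernel:
  fixes B :: "real^'m^'d"
  assumes R: "pos_def R" and "(B ** R ** transpose B) *v v = 0"
  shows "transpose B *v v = 0"
proof (rule ccontr)
  assume "transpose B *v v \<noteq> 0"
  then have "0 < (transpose B *v v) \<bullet> (R *v (transpose B *v v))"
    using R unfolding pos_def_def by blast
  then show False using assms(2) inner_congruence[of v "transpose B" R] by simp
qed

lemma lift_sandwich:
  "lift v ** T ** transpose (lift w) = (\<chi> p q. v $ fst p * w $ fst q * T $ snd p $ snd q)"
  by (simp add: vec_eq_iff lift_def transpose_def matrix_matrix_mult_def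
      if_distrib[where f = "\<lambda>x. _ * x"] if_distrib[where f = "\<lambda>x. x * _"] algebra_simps cong: if_cong)

lemma funpow_lift_kron_mat_1:
  fixes A :: "real^'d^'d" and w :: "real^'n"
  shows "transpose (lift w) *v (((*v) (kron (mat 1) A) ^^ k) x)
    = ((*v) A ^^ k) (transpose (lift w) *v x)"
  by (induction k)
    (simp, simp add: matrix_vector_mul_assoc lift_kron_mat_1, simp add: matrix_vector_mul_assoc[symmetric])

text \<open>A matrix of the form \<open>I \<otimes> X + E \<otimes> (Y - X) / n\<close> acts as \<open>X\<close> on \<open>w \<otimes> \<real>\<^sup>d\<close> for \<open>w\<close>
  orthogonal to the ones vector, and as \<open>Y\<close> for \<open>w\<close> parallel to it.\<close>

definition agent_block :: "real^'d^'d \<Rightarrow> real^'d^'d \<Rightarrow> real^('n::finite \<times> 'd)^('n \<times> 'd)" where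
  "agent_block X Y = kron (mat 1) X + (1 / real CARD('n)) *\<^sub>R kron ones_mat (Y - X)"

lemma agent_block_lift:
  fixes w :: "real^'n::finite"
  assumes "(ones_mat :: real^'n^'n) *v w = s *\<^sub>R w" "s = 0 \<or> s = real CARD('n)"
  shows "agent_block X Y ** lift w = lift w ** (if s = 0 then X else Y)"
proof -
  have "agent_block X Y ** lift w = lift w ** X + (s / real CARD('n)) *\<^sub>R (lift w ** (Y - X))"
    by (simp add: agent_block_def matrix_add_rdistrib matrix_scaleR_left kron_lift assms(1) lift_scaleR)
  then show ?thesis using assms(2) by (auto simp: matrix_diff_ldistrib)
qed

lemma agent_block_eqI:
  fixes T :: "real^('n::finite \<times> 'd::finite)^('n \<times> 'd)"
  assumes "\<And>(w :: real^'n) s. norm w = 1 \<Longrightarrow> (ones_mat :: real^'n^'n) *v w = s *\<^sub>R w \<Longrightarrow>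
      s = 0 \<or> s = real CARD('n) \<Longrightarrow> T ** lift w = T' ** lift w"
  shows "T = T'"
proof -
  have "T - T' = 0"
    by (rule zero_on_eigenvectors_of_ones_mat) (simp only: matrix_diff_rdistrib assms diff_self)
  then show ?thesis by simp
qed

lemma transpose_agent_block:
  "transpose X = X \<Longrightarrow> transpose Y = Y \<Longrightarrow> transpose (agent_block X Y) = agent_block X Y"
  by (simp add: agent_block_def transpose_distribs transpose_kron transpose_ones_mat)

text \<open>Block matrices multiply like pairs, so the n-agent Riccati equation splits into two
  single-agent equations.\<close>

lemma agent_block_mult:
  "(agent_block X Y :: real^('n::finite \<times> 'd::finite)^('n \<times> 'd)) ** agent_block X' Y'
    = agent_block (X ** X') (Y ** Y')"
proof (rule agent_block_eqI)
  fix w :: "real^'n" and s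
  assume "(ones_mat :: real^'n^'n) *v w = s *\<^sub>R w" "s = 0 \<or> s = real CARD('n)"
  note L = agent_block_lift[OF this]
  show "agent_block X Y ** agent_block X' Y' ** lift w = agent_block (X ** X') (Y ** Y') ** lift w"
    by (simp add: matrix_mul_assoc[symmetric] L) (simp add: matrix_mul_assoc L)
qed

lemma agent_block_same: "agent_block X X = kron (mat 1) X"
  by (simp add: agent_block_def kron_zero_right)

lemma agent_block_add: "agent_block X Y + agent_block X' Y' = agent_block (X + X') (Y + Y')"
  by (simp add: agent_block_def vec_eq_iff kron_def algebra_simps)

lemma agent_block_diff: "agent_block X Y - agent_block X' Y' = agent_block (X - X') (Y - Y')"
  by (simp add: agent_block_def vec_eq_iff kron_def algebra_simps)

text \<open>Pinching along the normalized ones vector writes the matrix as a sum of two semidefinite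
  ones; invertibility, from the product rule for blocks, makes it definite.\<close>

lemma pos_def_agent_block:
  fixes X Y :: "real^'d^'d"
  assumes X: "pos_def X" and Y: "pos_def Y"
  shows "pos_def (agent_block X Y :: real^('n::finite \<times> 'd)^('n \<times> 'd))"
    "matrix_inv (agent_block X Y :: real^('n \<times> 'd)^('n \<times> 'd)) = agent_block (matrix_inv X) (matrix_inv Y)"
proof -
  let ?B = "agent_block X Y :: real^('n \<times> 'd)^('n \<times> 'd)"
  let ?Z = "agent_block (matrix_inv X) (matrix_inv Y) :: real^('n \<times> 'd)^('n \<times> 'd)"
  \<comment> \<open>With this normalization \<open>w w'\<close> is the matrix of ones divided by n,
    the factor in \<open>agent_block_def\<close>.\<close>
  define w :: "real^'n" where "w = (\<chi> i. 1 / sqrt (real CARD('n)))"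
  let ?L = "lift w :: real^'d^('n \<times> 'd)"
  have w: "norm w = 1"
    by (simp add: norm_eq_1 inner_vec_def w_def)
  define P :: "real^('n \<times> 'd)^('n \<times> 'd)" where "P = mat 1 - ?L ** transpose ?L"
  have "(1 / real CARD('n)) *\<^sub>R kron (ones_mat :: real^'n^'n) (Y - X) = ?L ** (Y - X) ** transpose ?L"
    by (simp add: lift_sandwich vec_eq_iff kron_def ones_mat_def w_def)
  then have "?B = (transpose P ** kron (mat 1) X ** P + ?L ** X ** transpose ?L)
      + ?L ** (Y - X) ** transpose ?L"
    unfolding agent_block_def P_def kron_mat_1_pinching[OF w, symmetric] by simp
  then have B: "?B = transpose P ** kron (mat 1) X ** P + ?L ** Y ** transpose ?L"
    by (simp add: matrix_distribs)
  have psd: "pos_semidef ?B"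
    unfolding B
  proof (rule pos_semidef_add)
    show "pos_semidef (transpose P ** kron (mat 1) X ** P)"
      by (rule pos_semidef_congruence[OF pos_semidef_kron_mat_1[OF pos_def_imp_pos_semidef[OF X]]])
    show "pos_semidef (?L ** Y ** transpose ?L)"
      using pos_semidef_congruence[OF pos_def_imp_pos_semidef[OF Y], of "transpose ?L"] by simp
  qed
  have BZ: "?B ** ?Z = mat 1" and ZB: "?Z ** ?B = mat 1"
    using pos_def_inverse(1,2)[OF X] pos_def_inverse(1,2)[OF Y]
    by (simp_all add: agent_block_mult agent_block_same kron_mat_1)
  show "matrix_inv ?B = ?Z" by (rule matrix_inv_unique[OF BZ])
  have inj: "x = 0" if "?B *v x = 0" for x
    using that ZB by (metis matrix_vector_mul_assoc matrix_vector_mul_lid matrix_vector_mult_0_right)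
  have "0 < x \<bullet> (?B *v x)" if "x \<noteq> 0" for x
    using that inj[of x] pos_semidefD[OF psd, of x] pos_semidef_kernel[OF psd, of x]
    by (cases "x \<bullet> (?B *v x) = 0") auto
  then show "pos_def ?B" using psd by (simp add: pos_def_def pos_semidef_def)
qed

text \<open>The greatest dual solution \<open>Z\<close> dominates \<open>D\<close>, the inverse of the block solution, while the
  compressions of \<open>Z\<close> to the blocks are subsolutions and hence dominated by those of \<open>D\<close>.  So the
  positive semidefinite matrix \<open>Z - D\<close> vanishes on every block.\<close>

proposition minimal_agent_block:
  fixes A S M Q X X1 :: "real^'d^'d"
  assumes Q: "pos_semidef Q" and S: "pos_semidef S" and M: "transpose M = M"
    and ctrl: "\<And>v. (\<And>k. S *v (((*v) (transpose A) ^^ k) v) = 0) \<Longrightarrow> v = 0"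
    and X: "pos_def X" "riccati_eq A S Q X"
    and X1: "minimal_pd_solution (riccati_eq A M Q) X1"
  shows "minimal_pd_solution (riccati_eq (kron (mat 1) A) (agent_block S M) (kron (mat 1) Q))
    (agent_block X X1 :: real^('n::finite \<times> 'd)^('n \<times> 'd))"
proof -
  let ?A = "kron (mat 1) A :: real^('n \<times> 'd)^('n \<times> 'd)"
  let ?Q = "kron (mat 1) Q :: real^('n \<times> 'd)^('n \<times> 'd)"
  let ?S = "kron (mat 1) S :: real^('n \<times> 'd)^('n \<times> 'd)"
  let ?M = "agent_block S M :: real^('n \<times> 'd)^('n \<times> 'd)"
  let ?X = "agent_block X X1 :: real^('n \<times> 'd)^('n \<times> 'd)"
  let ?Zt = "matrix_inv X" and ?Z1 = "matrix_inv X1"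
  define D where "D = matrix_inv ?X"
  have pX1: "pos_def X1" and rX1: "riccati_eq A M Q X1"
    using X1 by (simp_all add: minimal_pd_solution_def)
  have tS: "transpose S = S" using S by (simp add: pos_semidef_def)
  have tM: "transpose ?M = ?M" by (rule transpose_agent_block[OF tS M])
  have pX: "pos_def ?X" by (rule pos_def_agent_block(1)[OF X(1) pX1])
  have D: "D = agent_block ?Zt ?Z1" unfolding D_def by (rule pos_def_agent_block(2)[OF X(1) pX1])
  have tD: "transpose D = D" using pos_def_inverse(3)[OF pX] by (simp add: D_def pos_def_def)
  have tA: "transpose (agent_block A A :: real^('n \<times> 'd)^('n \<times> 'd)) = agent_block (transpose A) (transpose A)"
    by (simp add: agent_block_same transpose_kron)
  \<comment> \<open>On pairs this is the equation of \<open>X\<close> with \<open>S\<close> next to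
    that of \<open>X1\<close> with \<open>M\<close>.\<close>
  have rX: "riccati_eq ?A ?M ?Q ?X"
    using X(2) rX1 unfolding riccati_eq_def agent_block_same[symmetric]
    by (simp add: tA agent_block_mult agent_block_add agent_block_diff)
      (simp add: agent_block_same kron_zero_right)
  have resD: "dual_residual ?A ?M ?Q D = 0"
    unfolding D_def by (rule dual_residual_matrix_inv[OF pX rX])
  have pZt: "pos_def ?Zt" by (rule pos_def_inverse(3)[OF X(1)])
  have resZt: "dual_residual A S Q ?Zt = 0" by (rule dual_residual_matrix_inv[OF X])
  have tZt: "transpose ?Zt = ?Zt" using pZt by (simp add: pos_def_def)
  have as: "antistable (A + ?Zt ** Q)"
    by (rule antistable_if_dual_solution[OF pZt resZt Q S ctrl])
  have pK: "pos_def (kron (mat 1) ?Zt :: real^('n \<times> 'd)^('n \<times> 'd))"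
    by (rule pos_def_kron_mat_1[OF pZt])
  have "riccati_eq ?A ?S ?Q (kron (mat 1) X)"
    using X(2)
    by (simp add: riccati_eq_def transpose_kron kron_mult kron_add_right[symmetric]
        kron_diff_right[symmetric] kron_zero_right)
  moreover have "matrix_inv (kron (mat 1) X :: real^('n \<times> 'd)^('n \<times> 'd)) = kron (mat 1) ?Zt"
    using pos_def_agent_block(2)[OF X(1) X(1)] by (simp add: agent_block_same)
  ultimately have resK: "dual_residual ?A ?S ?Q (kron (mat 1) ?Zt) = 0"
    using dual_residual_matrix_inv[OF pos_def_kron_mat_1[OF X(1)]] by metis
  \<comment> \<open>The Newton start solves the equation with \<open>?S\<close> in place of
    \<open>?M\<close>; antistability involves only \<open>?A\<close>, \<open>?Q\<close> and the
    start itself.\<close>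
  have asK: "antistable (?A + kron (mat 1) ?Zt ** ?Q)"
  proof (rule antistable_if_dual_solution[OF pK resK pos_semidef_kron_mat_1[OF Q] pos_semidef_kron_mat_1[OF S]])
    fix v :: "real^('n \<times> 'd)"
    assume v: "\<And>k. ?S *v (((*v) (transpose ?A) ^^ k) v) = 0"
    show "v = 0"
    proof (rule lift_axis_separating, rule ctrl)
      fix j k
      have "S *v (((*v) (transpose A) ^^ k) (transpose (lift (axis j 1)) *v v))
          = S *v (transpose (lift (axis j 1)) *v (((*v) (transpose ?A) ^^ k) v))"
        by (simp add: transpose_kron funpow_lift_kron_mat_1)
      also have "\<dots> = transpose (lift (axis j 1)) *v (?S *v (((*v) (transpose ?A) ^^ k) v))"
        by (simp add: matrix_vector_mul_assoc lift_kron_mat_1)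
      finally show "S *v (((*v) (transpose A) ^^ k) (transpose (lift (axis j 1)) *v v)) = 0"
        by (simp add: v)
    qed
  qed
  have tK: "transpose (kron (mat 1) ?Zt) = (kron (mat 1) ?Zt :: real^('n \<times> 'd)^('n \<times> 'd))"
    using pK by (simp add: pos_def_def)
  have subD: "pos_semidef (- dual_residual ?A ?M ?Q D)" by (simp add: resD pos_semidef_zero)
  obtain Z where Z: "transpose Z = Z" "dual_residual ?A ?M ?Q Z = 0"
    and great: "\<And>V. transpose V = V \<Longrightarrow> pos_semidef (- dual_residual ?A ?M ?Q V) \<Longrightarrow> psd_le V Z"
    using greatest_dual_solution[OF pos_semidef_kron_mat_1[OF Q] tM tK asK tD subD] by blast
  have ZD: "pos_semidef (Z - D)" using great[OF tD subD] by (simp add: psd_le_def)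
  have "Z = D"
  proof (rule agent_block_eqI)
    fix w :: "real^'n" and s
    assume w: "norm w = 1" and s: "(ones_mat :: real^'n^'n) *v w = s *\<^sub>R w" "s = 0 \<or> s = real CARD('n)"
    let ?L = "lift w :: real^'d^('n \<times> 'd)"
    let ?C = "transpose ?L ** Z ** ?L"
    note block = agent_block_lift[OF s]
    have "pos_semidef (- dual_residual A (if s = 0 then S else M) Q ?C)"
      by (rule dual_residual_compress[OF w Q block Z(1)]) (simp add: Z(2) pos_semidef_zero)
    moreover have "transpose ?C = ?C" by (simp add: matrix_transpose_mul matrix_mul_assoc Z(1))
    \<comment> \<open>For \<open>s = 0\<close> the bound comes from antistability at
      \<open>?Zt\<close>, for \<open>s = n\<close> from the minimality of \<open>X1\<close>.\<close>
    ultimately have "psd_le ?C (if s = 0 then ?Zt else ?Z1)"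
      using dual_subsolution_le_solution[OF as tZt _ Q resZt, of ?C]
        minimal_solution_inverse_greatest[OF Q M tZt as X1, of ?C] by (cases "s = 0") simp_all
    moreover have "(if s = 0 then ?Zt else ?Z1) = transpose ?L ** D ** ?L"
      using block[of ?Zt ?Z1] lift_orthonormal[OF w, where 'd = 'd]
      by (simp add: D matrix_mul_assoc[symmetric]) (simp add: matrix_mul_assoc)
    ultimately have le: "pos_semidef (transpose ?L ** (D - Z) ** ?L)"
      by (simp add: psd_le_def matrix_distribs)
    \<comment> \<open>The form of the semidefinite \<open>Z - D\<close> vanishes on the range of
      \<open>?L\<close>, so \<open>Z - D\<close> annihilates that range; this removes the
      off-diagonal blocks too.\<close>
    have "(Z - D) *v (?L *v u) = 0" for u
    proof (rule pos_semidef_kernel[OF ZD])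
      have "0 \<le> (?L *v u) \<bullet> ((D - Z) *v (?L *v u))"
        using pos_semidefD[OF le, of u] by (simp add: inner_congruence)
      moreover have "0 \<le> (?L *v u) \<bullet> ((Z - D) *v (?L *v u))" by (rule pos_semidefD[OF ZD])
      ultimately show "(?L *v u) \<bullet> ((Z - D) *v (?L *v u)) = 0"
        by (simp add: matrix_vector_mult_diff_rdistrib inner_diff_right)
    qed
    then have "(Z - D) ** ?L = 0" by (simp add: matrix_eq matrix_vector_mul_assoc)
    then show "Z ** ?L = D ** ?L" by (simp add: matrix_diff_rdistrib)
  qed
  \<comment> \<open>\<open>Y\<close> is arbitrary and may couple the agents: its inverse is a dual
    solution, hence below \<open>Z = D\<close>, and inverting again reverses the order.\<close>
  have "psd_le ?X Y" if Y: "pos_def Y" "riccati_eq ?A ?M ?Q Y" for Y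
  proof -
    have pY: "pos_def (matrix_inv Y)" by (rule pos_def_inverse(3)[OF Y(1)])
    have "psd_le (matrix_inv Y) (matrix_inv ?X)"
      unfolding D_def[symmetric] \<open>Z = D\<close>[symmetric]
      using pY by (intro great) (simp_all add: pos_def_def dual_residual_matrix_inv[OF Y] pos_semidef_zero)
    then have "psd_le (matrix_inv (matrix_inv ?X)) (matrix_inv (matrix_inv Y))"
      by (rule pos_def_psd_le_inverse[OF pY pos_def_inverse(3)[OF pX]])
    then show ?thesis by (simp add: matrix_inv_involution pX Y(1))
  qed
  then show ?thesis using pX rX by (simp add: minimal_pd_solution_def)
qed

section \<open>The n-agent equation and its cost\<close>

text \<open>Multiplying the equation by n and absorbing the factors into \<open>n X\<close> removes
  n from the \<open>S\<close> and \<open>Q\<close> terms and leaves \<open>\<theta> / n\<close>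
  before \<open>E \<otimes> W\<close>, which is the block form.\<close>

lemma agent_riccati_iff:
  fixes X :: "real^('n::finite \<times> 'd::finite)^('n \<times> 'd)" and B :: "real^'m^'d"
  assumes R: "pos_def R"
  defines "S \<equiv> B ** matrix_inv R ** transpose B"
  shows "agent_riccati A B W Q R \<theta> X \<longleftrightarrow>
    riccati_eq (kron (mat 1) A) (agent_block S (S - \<theta> *\<^sub>R W)) (kron (mat 1) Q) (real CARD('n) *\<^sub>R X)"
proof -
  let ?n = "real CARD('n)"
  let ?A = "kron (mat 1) A :: real^('n \<times> 'd)^('n \<times> 'd)"
  let ?Q = "kron (mat 1) Q :: real^('n \<times> 'd)^('n \<times> 'd)"
  let ?S = "kron (mat 1) S :: real^('n \<times> 'd)^('n \<times> 'd)"
  let ?W = "kron ones_mat W :: real^('n \<times> 'd)^('n \<times> 'd)"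
  have "matrix_inv (kron (mat 1 :: real^'n^'n) R) = kron (mat 1) (matrix_inv R)"
    by (intro matrix_inv_unique) (simp add: kron_mult pos_def_inverse[OF R] kron_mat_1)
  then have S: "kron (mat 1 :: real^'n^'n) B ** matrix_inv (kron (mat 1 :: real^'n^'n) R)
      ** transpose (kron (mat 1 :: real^'n^'n) B) = ?S"
    by (simp add: S_def kron_mult transpose_kron)
  have M: "?n *\<^sub>R (?S - (\<theta> / ?n) *\<^sub>R ?W) = ?n *\<^sub>R ?S - \<theta> *\<^sub>R ?W"
    by (simp add: scaleR_diff_right)
  have B: "agent_block S (S - \<theta> *\<^sub>R W) = ?S - (\<theta> / ?n) *\<^sub>R ?W"
    by (simp add: agent_block_def vec_eq_iff kron_def)
  let ?E = "transpose ?A ** X + X ** ?A - X ** (?n *\<^sub>R (?S - (\<theta> / ?n) *\<^sub>R ?W)) ** X + (1 / ?n) *\<^sub>R ?Q"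
  let ?E' = "transpose ?A ** (?n *\<^sub>R X) + (?n *\<^sub>R X) ** ?A
      - (?n *\<^sub>R X) ** (?S - (\<theta> / ?n) *\<^sub>R ?W) ** (?n *\<^sub>R X) + ?Q"
  have "?E' = ?n *\<^sub>R ?E"
    by (simp only: matrix_scaleR_left matrix_scaleR_right) (simp add: algebra_simps)
  then show ?thesis
    by (simp add: agent_riccati_def riccati_eq_def Let_def S M[symmetric] B)
qed

lemma agent_minimal_pd_solution:
  fixes A W Q X1 X1_tilde :: "real^'d^'d" and B :: "real^'m^'d"
  assumes W: "transpose W = W" and Q: "pos_semidef Q" and R: "pos_def R"
    and ctrl: "controllable A B"
    and Xt: "pos_def X1_tilde" "riccati_eq A (B ** matrix_inv R ** transpose B) Q X1_tilde"
    and X1: "minimal_pd_solution (single_riccati A B W Q R \<theta>) X1"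
  shows "minimal_pd_solution (agent_riccati A B W Q R \<theta>)
    ((1 / real CARD('n)) *\<^sub>R agent_block X1_tilde X1 :: real^('n::finite \<times> 'd)^('n \<times> 'd))"
proof -
  let ?n = "real CARD('n)"
  let ?X = "agent_block X1_tilde X1 :: real^('n \<times> 'd)^('n \<times> 'd)"
  define S where "S = B ** matrix_inv R ** transpose B"
  have pR: "pos_def (matrix_inv R)" by (rule pos_def_inverse(3)[OF R])
  have S: "pos_semidef S"
    using pos_semidef_congruence[OF pos_def_imp_pos_semidef[OF pR], of "transpose B"]
    by (simp add: S_def)
  have M: "transpose (S - \<theta> *\<^sub>R W) = S - \<theta> *\<^sub>R W"
    using S W by (simp add: transpose_distribs pos_semidef_def)
  have "v = 0" if "\<And>k. S *v (((*v) (transpose A) ^^ k) v) = 0" for v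
    by (rule controllable_imp_kernel_zero[OF ctrl])
      (rule pos_def_congruence_kernel[OF pR that[unfolded S_def]])
  moreover have "minimal_pd_solution (riccati_eq A (S - \<theta> *\<^sub>R W) Q) X1"
    using X1 by (simp add: minimal_pd_solution_def single_riccati_def S_def)
  ultimately have min: "minimal_pd_solution
      (riccati_eq (kron (mat 1) A) (agent_block S (S - \<theta> *\<^sub>R W)) (kron (mat 1) Q)) ?X"
    using Xt minimal_agent_block[OF Q S M] unfolding S_def by blast
  show ?thesis
    unfolding minimal_pd_solution_def agent_riccati_iff[OF R] S_def[symmetric]
  proof (intro conjI allI impI)
    show "pos_def ((1 / ?n) *\<^sub>R ?X)"
      using min by (intro pos_def_scaleR) (simp_all add: minimal_pd_solution_def)
    show "riccati_eq (kron (mat 1) A) (agent_block S (S - \<theta> *\<^sub>R W)) (kron (mat 1) Q)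
        (?n *\<^sub>R (1 / ?n) *\<^sub>R ?X)"
      using min by (simp add: minimal_pd_solution_def)
    fix Y :: "real^('n \<times> 'd)^('n \<times> 'd)"
    assume "pos_def Y" "riccati_eq (kron (mat 1) A) (agent_block S (S - \<theta> *\<^sub>R W)) (kron (mat 1) Q) (?n *\<^sub>R Y)"
    then have "psd_le ?X (?n *\<^sub>R Y)"
      using min pos_def_scaleR[of Y ?n] by (simp add: minimal_pd_solution_def)
    then have "pos_semidef ((1 / ?n) *\<^sub>R (?n *\<^sub>R Y - ?X))"
      by (intro pos_semidef_scaleR) (simp_all add: psd_le_def)
    then show "psd_le ((1 / ?n) *\<^sub>R ?X) Y" by (simp add: psd_le_def scaleR_diff_right)
  qed
qed

lemma the_minimal_pd_solution:
  "minimal_pd_solution E X \<Longrightarrow> (THE X. minimal_pd_solution E X) = X"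
  by (rule the_equality) (auto simp: minimal_pd_solution_def intro: psd_le_antisym)

text \<open>Since \<open>E E = n E\<close> and \<open>E\<close> has trace n, all factors n cancel,
  and the two contributions of \<open>X\<close> cancel each other.\<close>

lemma trace_agent_block:
  fixes W X Y :: "real^'d^'d"
  shows "trace (kron (ones_mat :: real^'n::finite^'n) W ** ((1 / real CARD('n)) *\<^sub>R agent_block X Y))
    = trace (W ** Y)"
  by (simp add: agent_block_def matrix_distribs kron_mult ones_mat_square kron_scaleR_left
      trace_scaleR trace_add trace_sub trace_kron trace_ones_mat field_simps)

text \<open>The right-hand side contains no number of agents, so instances for \<open>'n\<close> and
  for the one-element type can be equated.\<close>

lemma J_star_eq_trace:
  fixes A W Q X1 X1_tilde :: "real^'d^'d" and B :: "real^'m^'d"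
  assumes "transpose W = W" "pos_semidef Q" "pos_def R" "controllable A B"
    and "pos_def X1_tilde" "riccati_eq A (B ** matrix_inv R ** transpose B) Q X1_tilde"
    and "minimal_pd_solution (single_riccati A B W Q R \<theta>) X1"
  shows "J_star A B W Q R \<theta> (n :: 'n::finite itself) = trace (W ** X1)"
  unfolding J_star_def the_minimal_pd_solution[OF agent_minimal_pd_solution[OF assms]]
    trace_agent_block ..

theorem mainTheorem2:
  fixes A G W Q X1 X1_tilde X1_hat :: "real^'d^'d"
    and B :: "real^'m^'d"
    and R :: "real^'m^'m"
    and \<theta> :: real
    and Xn :: "real^('n \<times> 'd)^('n::finite \<times> 'd)"
  assumes "W = G ** transpose G"
    and "pos_semidef Q"
    and "pos_def R"
    and "controllable A B"
    and "observable A Q"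
    and "ereal \<theta> < theta_star A B W Q R"
    and "pos_def X1_tilde"
    and "riccati_eq A (B ** matrix_inv R ** transpose B) Q X1_tilde"
    and "minimal_pd_solution (single_riccati A B W Q R \<theta>) X1"
    and "X1_hat = X1 - X1_tilde"
    and "Xn = (1 / real CARD('n)) *\<^sub>R kron (mat 1 :: real^'n^'n) X1_tilde
            + (1 / (real CARD('n))\<^sup>2) *\<^sub>R kron (ones_mat :: real^'n^'n) X1_hat"
  shows "minimal_pd_solution (agent_riccati A B W Q R \<theta>) Xn
       \<and> J_star A B W Q R \<theta> TYPE('n) = trace (kron (ones_mat :: real^'n^'n) W ** Xn)
       \<and> J_star A B W Q R \<theta> TYPE('n) = trace (W ** (X1_tilde + X1_hat))
       \<and> trace (W ** (X1_tilde + X1_hat)) = J_star A B W Q R \<theta> TYPE(1)"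
proof -
  have W: "transpose W = W" using assms(1) by (simp add: matrix_transpose_mul)
  have X1: "X1_tilde + X1_hat = X1" using assms(10) by simp
  note single = W assms(2,3,4,7,8,9)
  have Xn: "Xn = (1 / real CARD('n)) *\<^sub>R agent_block X1_tilde X1"
    by (simp add: assms(10,11) agent_block_def scaleR_add_right power2_eq_square)
  show ?thesis
    using agent_minimal_pd_solution[OF single, where 'n = 'n]
    by (simp add: Xn trace_agent_block X1 J_star_eq_trace[OF single])
qed

end
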